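(* In the elliptically symmetric deformation model $p(\bm x,\bm\theta)=|\Lambda|f(\Lambda(\bm x-\bm\mu))$ with $\Lambda$ symmetric positive definite, if $f$ is the standard Gaussian density $f(\bm z)=(2\pi)^{-d/2}e^{-\|\bm z\|^2/2}$, then for observations $\bm x_1,\dots,\bm x_n$ with positive definite sample covariance, the maximum likelihood estimator $\hat{\bm\theta}_F$ and the Wasserstein estimator $\hat{\bm\theta}_W$ coincide (both equal $(\bar{\bm x},\hat\Sigma^{-1/2})$ with $\bar{\bm x}$ the sample mean and $\hat\Sigma$ the sample covariance with divisor $n$).
   Context: The Wasserstein estimator $\hat{\bm\theta}_W$ is the solution of $\frac1n\sum_{t=1}^nS^W_k(\bm x_t,\bm\theta)=0$ for all parameters $\theta_k$, where the Wasserstein score $S^W_k$ solves $\nabla_{\bm x}\cdot(p(\bm x,\bm\theta)\nabla_{\bm x}S^W_k)=-\partial_{\theta_k}p(\bm x,\bm\theta)$ with $\mathrm{E}_{\bm\theta}[S^W_k]=0$. The maximum likelihood estimator $\hat{\bm\theta}_F$ solves $\frac1n\sum_t\partial_{\theta_k}\log p(\bm x_t,\bm\theta)=0$. *)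

theory Defs
  imports "HOL-Analysis.Analysis"
begin

definition sym_mat :: "real^'d^'d \<Rightarrow> bool" where
  "sym_mat A \<longleftrightarrow> transpose A = A"

definition pos_def :: "real^'d^'d \<Rightarrow> bool" where
  "pos_def A \<longleftrightarrow> sym_mat A \<and> (\<forall>v. v \<noteq> 0 \<longrightarrow> v \<bullet> (A *v v) > 0)"

definition param_space :: "((real^'d) \<times> (real^'d^'d)) set" where
  "param_space = {(\<mu>, \<Lambda>). pos_def \<Lambda>}"

definition ell_model :: "(real^'d \<Rightarrow> real) \<Rightarrow> real^'d \<Rightarrow> ((real^'d) \<times> (real^'d^'d)) \<Rightarrow> real" where
  "ell_model f x \<theta> = \<bar>det (snd \<theta>)\<bar> * f (snd \<theta> *v (x - fst \<theta>))"

definition gauss_density :: "real^'d \<Rightarrow> real" where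
  "gauss_density z = (2 * pi) powr (- real CARD('d) / 2) * exp (- (norm z)\<^sup>2 / 2)"

(* symmetric unit matrix: direction of the free parameter Lambda_ij = Lambda_ji *)
definition sym_unit :: "'d \<Rightarrow> 'd \<Rightarrow> real^'d^'d" where
  "sym_unit i j = (\<chi> a b. if (a = i \<and> b = j) \<or> (a = j \<and> b = i) then 1 else 0)"

definition param_dirs :: "((real^'d) \<times> (real^'d^'d)) set" where
  "param_dirs = {(axis i 1, 0) | i. True} \<union> {(0, sym_unit i j) | i j. True}"

definition param_deriv ::
  "(real^'d \<Rightarrow> ((real^'d) \<times> (real^'d^'d)) \<Rightarrow> real) \<Rightarrow> real^'d \<Rightarrow> ((real^'d) \<times> (real^'d^'d))
     \<Rightarrow> ((real^'d) \<times> (real^'d^'d)) \<Rightarrow> real" where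
  "param_deriv p x \<theta> v = deriv (\<lambda>t. p x (\<theta> + t *\<^sub>R v)) 0"

definition divergence :: "(real^'d \<Rightarrow> real^'d) \<Rightarrow> real^'d \<Rightarrow> real" where
  "divergence F x = (\<Sum>i\<in>UNIV. (frechet_derivative F (at x) (axis i 1)) $ i)"

(* S is a Wasserstein score for direction v at theta:
   S is C^2 with gradient G, div(p grad S) = - d_theta p, E_theta[S] = 0,
   and S, grad S are square integrable w.r.t. p (the class in which the score is unique) *)
definition w_score ::
  "(real^'d \<Rightarrow> ((real^'d) \<times> (real^'d^'d)) \<Rightarrow> real) \<Rightarrow> ((real^'d) \<times> (real^'d^'d))
     \<Rightarrow> ((real^'d) \<times> (real^'d^'d)) \<Rightarrow> (real^'d \<Rightarrow> real) \<Rightarrow> bool" where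
  "w_score p \<theta> v S \<longleftrightarrow>
     (\<exists>G G'. (\<forall>y. (S has_derivative (\<lambda>h. G y \<bullet> h)) (at y))
          \<and> (\<forall>y. (G has_derivative blinfun_apply (G' y)) (at y))
          \<and> continuous_on UNIV G'
          \<and> (\<forall>y. divergence (\<lambda>z. p z \<theta> *\<^sub>R G z) y = - param_deriv p y \<theta> v)
          \<and> integrable lborel (\<lambda>y. p y \<theta> * S y)
          \<and> (\<integral>y. p y \<theta> * S y \<partial>lborel) = 0
          \<and> integrable lborel (\<lambda>y. p y \<theta> * (S y)\<^sup>2)
          \<and> integrable lborel (\<lambda>y. p y \<theta> * (norm (G y))\<^sup>2))"

definition mle_set ::
  "(real^'d \<Rightarrow> ((real^'d) \<times> (real^'d^'d)) \<Rightarrow> real) \<Rightarrow> nat \<Rightarrow> (nat \<Rightarrow> real^'d)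
     \<Rightarrow> ((real^'d) \<times> (real^'d^'d)) set" where
  "mle_set p n x = {\<theta> \<in> param_space. \<forall>v\<in>param_dirs.
      (1 / real n) * (\<Sum>t=1..n. param_deriv (\<lambda>y \<theta>'. ln (p y \<theta>')) (x t) \<theta> v) = 0}"

definition wass_set ::
  "(real^'d \<Rightarrow> ((real^'d) \<times> (real^'d^'d)) \<Rightarrow> real) \<Rightarrow> nat \<Rightarrow> (nat \<Rightarrow> real^'d)
     \<Rightarrow> ((real^'d) \<times> (real^'d^'d)) set" where
  "wass_set p n x = {\<theta> \<in> param_space. \<forall>v\<in>param_dirs.
      \<exists>S. w_score p \<theta> v S \<and> (1 / real n) * (\<Sum>t=1..n. S (x t)) = 0}"

definition sample_mean :: "nat \<Rightarrow> (nat \<Rightarrow> real^'d) \<Rightarrow> real^'d" where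
  "sample_mean n x = (1 / real n) *\<^sub>R (\<Sum>t=1..n. x t)"

definition sample_cov :: "nat \<Rightarrow> (nat \<Rightarrow> real^'d) \<Rightarrow> real^'d^'d" where
  "sample_cov n x = (1 / real n) *\<^sub>R (\<Sum>t=1..n.
      (\<chi> i j. (x t - sample_mean n x) $ i * (x t - sample_mean n x) $ j))"

definition inv_sqrt :: "real^'d^'d \<Rightarrow> real^'d^'d" where
  "inv_sqrt A = (THE L. pos_def L \<and> L ** L = matrix_inv A)"

end

theory Submission
  imports Defs "HOL-Probability.Distributions"
begin

text \<open>With \<open>y = x - \<mu>\<close>, the log-likelihood score in direction \<open>(u, V)\<close> is
  \<open>\<Lambda>\<inverse> \<bullet> V - (\<Lambda> y) \<bullet> (V y - \<Lambda> u)\<close> (Frobenius inner product), and the Wasserstein score is the quadratic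
  polynomial \<open>u \<bullet> y + y \<bullet> H y / 2 - H \<bullet> \<Lambda>\<^sup>-\<^sup>2 / 2\<close>, where \<open>H\<close> solves
  \<open>\<Lambda>\<^sup>2 H + H \<Lambda>\<^sup>2 = - (\<Lambda> V + V \<Lambda>)\<close>; an energy estimate with cutoffs shows that it is the only one. Averaging
  over the sample, the directions \<open>u\<close> force \<open>\<mu>\<close> to be the sample mean. In the directions \<open>V\<close> both
  equations reduce to a homogeneous Lyapunov equation \<open>\<Lambda> X + X \<Lambda> = 0\<close>, whose only solution for positive definite
  \<open>\<Lambda>\<close> is \<open>0\<close>, and so both say that the sample covariance is \<open>\<Lambda>\<^sup>-\<^sup>2\<close>.\<close>

section \<open>Positive definite matrices\<close>

text \<open>\<open>wass_set\<close> only asks for some score with zero average, so nothing can be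
  read off it before the score is known to be unique; this is what the square integrability in
  \<open>w_score\<close> is spent on. The directions \<open>V\<close> are symmetric, so the
  likelihood equations see only the symmetric part of \<open>L ** X\<close>, where \<open>X\<close>
  is the sample covariance minus \<open>P ** P\<close> and \<open>P\<close> is the inverse of
  \<open>L\<close>; twice that part is the Lyapunov expression. On the Wasserstein side the test
  matrices \<open>H\<close> are themselves Lyapunov solutions. The Lyapunov operator is
  self-adjoint, so it is inverted on \<open>X\<close> instead, and the same kind of expression
  appears for the solution \<open>Y\<close>. Solvability of these equations and uniqueness of square
  roots both rest on one energy argument in the Frobenius inner product rather than on
  diagonalisation. Gaussian moments are never computed: the score has mean zero because
  \<open>p\<close> times the score is itself a divergence.\<close>

lemma inner_mat_eq_sum: "(A::real^'n^'m) \<bullet> B = (\<Sum>i\<in>UNIV. \<Sum>j\<in>UNIV. A $ i $ j * B $ i $ j)"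
  by (simp add: inner_vec_def)

lemma inner_transpose: "transpose (A::real^'n^'m) \<bullet> transpose B = A \<bullet> B"
  unfolding inner_mat_eq_sum transpose_def by (simp, rule sum.swap)

lemma inner_matrix_mult_right: "(A::real^'n^'m) \<bullet> (B ** C) = (transpose B ** A) \<bullet> C"
proof -
  have "A \<bullet> (B ** C) = (\<Sum>i\<in>UNIV. \<Sum>j\<in>UNIV. \<Sum>k\<in>UNIV. A $ i $ j * B $ i $ k * C $ k $ j)"
    by (simp add: inner_mat_eq_sum matrix_matrix_mult_def sum_distrib_left mult.assoc)
  also have "\<dots> = (\<Sum>i\<in>UNIV. \<Sum>k\<in>UNIV. \<Sum>j\<in>UNIV. A $ i $ j * B $ i $ k * C $ k $ j)"
    by (intro sum.cong refl sum.swap)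
  also have "\<dots> = (\<Sum>k\<in>UNIV. \<Sum>i\<in>UNIV. \<Sum>j\<in>UNIV. A $ i $ j * B $ i $ k * C $ k $ j)"
    by (rule sum.swap)
  also have "\<dots> = (\<Sum>k\<in>UNIV. \<Sum>j\<in>UNIV. \<Sum>i\<in>UNIV. A $ i $ j * B $ i $ k * C $ k $ j)"
    by (intro sum.cong refl sum.swap)
  also have "\<dots> = (transpose B ** A) \<bullet> C"
    by (simp add: inner_mat_eq_sum matrix_matrix_mult_def sum_distrib_left transpose_def mult_ac)
  finally show ?thesis .
qed

lemma inner_matrix_mult_left: "(A::real^'n^'m) \<bullet> (B ** C) = (A ** transpose C) \<bullet> B"
proof -
  have "A \<bullet> (B ** C) = transpose A \<bullet> (transpose C ** transpose B)"
    by (metis inner_transpose matrix_transpose_mul)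
  also have "\<dots> = transpose (A ** transpose C) \<bullet> transpose B"
    by (simp add: inner_matrix_mult_right matrix_transpose_mul)
  finally show ?thesis by (simp add: inner_transpose)
qed

lemma bilinear_matrix_mult: "bilinear ((**) :: real^'n^'m \<Rightarrow> real^'k^'n \<Rightarrow> real^'k^'m)"
  unfolding bilinear_def
  by (auto intro!: linearI simp: vec_eq_iff matrix_matrix_mult_def sum.distrib sum_distrib_left algebra_simps)

lemmas matrix_add_rdistrib = bilinear_ladd[OF bilinear_matrix_mult]
  and matrix_sub_ldistrib = bilinear_rsub[OF bilinear_matrix_mult]
  and matrix_sub_rdistrib = bilinear_lsub[OF bilinear_matrix_mult]
  and matrix_scaleR_left = bilinear_lmul[OF bilinear_matrix_mult]
  and matrix_scaleR_right = bilinear_rmul[OF bilinear_matrix_mult]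

lemma transpose_add: "transpose (A + B) = transpose A + transpose B"
  by (simp add: transpose_def vec_eq_iff)

lemma transpose_diff: "transpose (A - B) = transpose A - (transpose B :: real^'n^'m)"
  by (simp add: transpose_def vec_eq_iff)

lemma transpose_uminus: "transpose (- A) = - (transpose A :: real^'n^'m)"
  by (simp add: transpose_def vec_eq_iff)

lemma inner_matrix_vector: "(u::real^'m) \<bullet> (A *v v) = (\<chi> i j. u $ i * v $ j) \<bullet> A"
  by (simp add: inner_mat_eq_sum inner_vec_def matrix_vector_mult_def sum_distrib_left mult_ac)

lemma inner_matrix_self:
  fixes X :: "real^'n^'d"
  shows "X \<bullet> (L ** X) = (\<Sum>j\<in>UNIV. column j X \<bullet> (L *v column j X))"
proof -
  have "X \<bullet> (L ** X) = (\<Sum>i\<in>UNIV. \<Sum>j\<in>UNIV. X $ i $ j * (L *v column j X) $ i)"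
    by (simp add: inner_mat_eq_sum matrix_matrix_mult_def matrix_vector_mult_def column_def)
  also have "\<dots> = (\<Sum>j\<in>UNIV. \<Sum>i\<in>UNIV. X $ i $ j * (L *v column j X) $ i)"
    by (rule sum.swap)
  also have "\<dots> = (\<Sum>j\<in>UNIV. column j X \<bullet> (L *v column j X))"
    by (simp add: inner_vec_def column_def)
  finally show ?thesis .
qed

section \<open>Positivity in the Frobenius inner product, Sylvester and Lyapunov equations\<close>

lemma pos_def_transpose: "pos_def A \<Longrightarrow> transpose A = A"
  by (simp add: pos_def_def sym_mat_def)

lemma pos_def_nonneg: "pos_def A \<Longrightarrow> 0 \<le> v \<bullet> (A *v v)"
  by (cases "v = 0") (auto simp: pos_def_def intro: less_imp_le)

lemma pos_def_inner_nonneg: "pos_def L \<Longrightarrow> 0 \<le> X \<bullet> (L ** X)"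
  by (simp add: inner_matrix_self sum_nonneg pos_def_nonneg)

lemma pos_def_inner_eq_0:
  assumes "pos_def L" "X \<bullet> (L ** X) = 0"
  shows "X = 0"
proof -
  have "(\<Sum>j\<in>UNIV. column j X \<bullet> (L *v column j X)) = 0"
    using assms(2) by (simp add: inner_matrix_self)
  hence "\<forall>j\<in>UNIV. column j X \<bullet> (L *v column j X) = 0"
    using assms(1) by (subst (asm) sum_nonneg_eq_0_iff) (auto intro: pos_def_nonneg)
  hence "\<forall>j. column j X = 0"
    using assms(1) by (metis UNIV_I less_irrefl pos_def_def)
  thus ?thesis by (simp add: column_def vec_eq_iff)
qed

text \<open>Pairing the equation with \<open>X\<close> leaves two nonnegative terms with sum zero;
  the second becomes a left multiplication by \<open>M\<close> after transposing. Two different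
  coefficients are allowed for the sake of \<open>pos_def_sqrt_unique\<close>.\<close>

lemma sylvester_eq_0:
  fixes X :: "real^'d^'d"
  assumes L: "pos_def L" and M: "pos_def M" and eq: "L ** X + X ** M = 0"
  shows "X = 0"
proof -
  have "X \<bullet> (X ** M) = transpose X \<bullet> (M ** transpose X)"
    by (metis M inner_transpose matrix_transpose_mul pos_def_transpose)
  hence "0 \<le> X \<bullet> (X ** M)" using pos_def_inner_nonneg[OF M] by simp
  moreover have "X \<bullet> (L ** X) + X \<bullet> (X ** M) = 0"
    using eq by (simp flip: inner_add_right)
  ultimately have "X \<bullet> (L ** X) = 0" using pos_def_inner_nonneg[OF L, of X] by simp
  thus ?thesis by (rule pos_def_inner_eq_0[OF L])
qed

text \<open>In finite dimension the trivial kernel from \<open>sylvester_eq_0\<close> gives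
  surjectivity. The solution is symmetric by injectivity, because its transpose solves the same
  equation.\<close>

lemma lyapunov_solvable:
  fixes M C :: "real^'d^'d"
  assumes M: "pos_def M" and C: "sym_mat C"
  obtains H where "sym_mat H" "M ** H + H ** M = C"
proof -
  let ?T = "\<lambda>H. M ** H + H ** M"
  have lin: "linear ?T"
    by (rule linearI) (simp_all only: matrix_add_ldistrib matrix_add_rdistrib
        matrix_scaleR_left matrix_scaleR_right scaleR_add_right ac_simps)
  have "inj ?T"
    unfolding linear_injective_0[OF lin] using sylvester_eq_0[OF M M] by blast
  hence "surj ?T" by (rule linear_inj_imp_surj[OF lin])
  from surjD[OF this, of C] obtain H where H: "M ** H + H ** M = C" by auto
  have "M ** transpose H + transpose H ** M = C"
    using arg_cong[OF H, of transpose] C pos_def_transpose[OF M]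
    by (simp add: transpose_add matrix_transpose_mul sym_mat_def add.commute)
  hence "transpose H = H" using injD[OF \<open>inj ?T\<close>, of "transpose H" H] H by simp
  thus ?thesis using H that by (simp add: sym_mat_def)
qed

lemma pos_def_matrix_inv:
  assumes "pos_def A"
  shows "A ** matrix_inv A = mat 1" "matrix_inv A ** A = mat 1" "pos_def (matrix_inv A)"
proof -
  have "\<exists>B. B ** A = mat 1"
    unfolding matrix_left_invertible_ker using assms by (metis inner_zero_right less_irrefl pos_def_def)
  hence inv: "invertible A" by (simp add: invertible_left_inverse)
  have *: "\<exists>A'. A ** A' = mat 1 \<and> A' ** A = mat 1"
    using inv by (simp add: invertible_def)
  show 1: "A ** matrix_inv A = mat 1" and 2: "matrix_inv A ** A = mat 1"
    unfolding matrix_inv_def using someI_ex[OF *] by auto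
  have "transpose (matrix_inv A) ** A = mat 1"
    by (metis 1 assms matrix_transpose_mul pos_def_transpose transpose_mat)
  hence sym: "transpose (matrix_inv A) = matrix_inv A"
    by (metis 1 matrix_mul_assoc matrix_mul_lid matrix_mul_rid)
  moreover have "v \<bullet> (matrix_inv A *v v) > 0" if "v \<noteq> 0" for v
  proof -
    define w where "w = matrix_inv A *v v"
    have "v = A *v w" by (simp add: w_def matrix_vector_mul_assoc 1)
    moreover from this that have "w \<noteq> 0" by auto
    ultimately show ?thesis
      using assms unfolding pos_def_def w_def by (metis inner_commute)
  qed
  ultimately show "pos_def (matrix_inv A)" by (simp add: pos_def_def sym_mat_def)
qed

text \<open>The difference of the roots solves a Sylvester equation with the roots as coefficients:
  the mixed products cancel and \<open>L ** L - M ** M\<close> is left.\<close>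

lemma pos_def_sqrt_unique:
  fixes L M :: "real^'d^'d"
  assumes L: "pos_def L" and M: "pos_def M" and eq: "L ** L = M ** M"
  shows "L = M"
proof -
  have "L ** (L - M) + (L - M) ** M = 0"
    using eq by (simp add: matrix_sub_ldistrib matrix_sub_rdistrib)
  from sylvester_eq_0[OF L M this] show ?thesis by simp
qed

section \<open>Coercivity and the positive definite square root\<close>

lemma sym_mat_inner_commute: "sym_mat A \<Longrightarrow> (A *v u) \<bullet> v = u \<bullet> (A *v (v::real^'d))"
  by (metis dot_lmul_matrix sym_mat_def transpose_matrix_vector vector_transpose_matrix)

lemma sym_matI:
  fixes A :: "real^'d^'d"
  assumes "\<And>u v. (A *v u) \<bullet> v = u \<bullet> (A *v v)"
  shows "sym_mat A"
proof -
  have "u \<bullet> (transpose A *v v) = u \<bullet> (A *v v)" for u v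
    by (metis assms dot_lmul_matrix inner_commute transpose_matrix_vector)
  thus ?thesis unfolding sym_mat_def by (metis matrix_eq vector_eq_ldot)
qed

text \<open>The constant is the minimum of the form on the unit sphere, extended by homogeneity. It
  supplies the contraction factor for the square root and the decay rate in
  \<open>integrable_p_grows\<close>.\<close>

lemma pos_def_coercive:
  fixes A :: "real^'d^'d"
  assumes "pos_def A"
  obtains m where "m > 0" "\<And>v. m * (norm v)\<^sup>2 \<le> v \<bullet> (A *v v)"
proof -
  have "continuous_on (sphere 0 1) (\<lambda>v. v \<bullet> (A *v v))"
    by (intro continuous_on_inner continuous_on_id linear_continuous_on matrix_vector_mul_bounded_linear)
  moreover have "sphere (0::real^'d) 1 \<noteq> {}" by simp
  ultimately obtain w where w: "w \<in> sphere 0 1" "\<And>v. v \<in> sphere 0 1 \<Longrightarrow> w \<bullet> (A *v w) \<le> v \<bullet> (A *v v)"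
    using continuous_attains_inf[OF compact_sphere, of 0 1 "\<lambda>v. v \<bullet> (A *v v)"] by blast
  show ?thesis
  proof (rule that)
    have "w \<noteq> 0" using w(1) by auto
    thus "w \<bullet> (A *v w) > 0" using assms by (simp add: pos_def_def)
    fix v show "(w \<bullet> (A *v w)) * (norm v)\<^sup>2 \<le> v \<bullet> (A *v v)"
    proof (cases "v = 0")
      case False
      define e where "e = v /\<^sub>R norm v"
      have "v = norm v *\<^sub>R e" "e \<in> sphere 0 1" using False by (auto simp: e_def)
      have "v \<bullet> (A *v v) = (norm v)\<^sup>2 * (e \<bullet> (A *v e))"
        by (subst (1 2) \<open>v = _\<close>) (simp add: matrix_vector_mult_scaleR power2_eq_square)
      thus ?thesis using w(2)[OF \<open>e \<in> _\<close>] by (simp add: mult.commute[of _ "(norm v)\<^sup>2"] mult_left_mono)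
    qed simp
  qed
qed

text \<open>For \<open>c\<close> small the matrix \<open>B = 1 - c A\<close> is a strict contraction, and a symmetric fixed point \<open>Y\<close> of
  \<open>Y \<mapsto> (B + Y\<^sup>2) / 2\<close> satisfies \<open>(1 - Y)\<^sup>2 = c A\<close>.\<close>

lemma pos_def_sqrt_exists:
  fixes A :: "real^'d^'d"
  assumes A: "pos_def A"
  obtains L where "pos_def L" "L ** L = A"
proof -
  obtain m where m: "m > 0" "\<And>v. m * (norm v)\<^sup>2 \<le> v \<bullet> (A *v v)"
    using pos_def_coercive[OF A] by blast
  obtain M where M: "M > 0" "\<And>v. norm (A *v v) \<le> norm v * M"
    using bounded_linear.pos_bounded[OF matrix_vector_mul_bounded_linear[of A]] by blast
  \<comment> \<open>This \<open>c\<close> minimises \<open>1 - 2 * c * m + c^2 * M^2\<close>, the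
    factor obtained by expanding the square in \<open>bd\<close>; the minimum is
    \<open>q\<close>.\<close>
  define c where "c = m / M\<^sup>2"
  define q where "q = 1 - m\<^sup>2 / M\<^sup>2"
  have c: "c > 0" using m M by (simp add: c_def)
  have bd: "(norm (v - c *\<^sub>R (A *v v)))\<^sup>2 \<le> q * (norm v)\<^sup>2" for v
  proof -
    have "(norm (v - c *\<^sub>R (A *v v)))\<^sup>2 = (norm v)\<^sup>2 - 2 * c * (v \<bullet> (A *v v)) + c\<^sup>2 * (norm (A *v v))\<^sup>2"
      unfolding power2_norm_eq_inner by (simp add: inner_diff inner_commute power2_eq_square algebra_simps)
    also have "\<dots> \<le> (norm v)\<^sup>2 - 2 * c * (m * (norm v)\<^sup>2) + c\<^sup>2 * (norm v * M)\<^sup>2"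
      using m(2)[of v] M(2)[of v] c by (intro add_mono diff_mono mult_left_mono power_mono) auto
    also have "\<dots> = q * (norm v)\<^sup>2"
      using M(1) by (simp add: c_def q_def field_simps power2_eq_square)
    finally show ?thesis .
  qed
  obtain e :: "real^'d" where e: "norm e = 1" using vector_choose_size[of 1] by auto
  have q: "0 \<le> q" using order_trans[OF zero_le_power2 bd[of e]] e by simp
  define b where "b = sqrt q"
  have b: "0 \<le> b" "b < 1" using q m M by (auto simp: b_def q_def)
  \<comment> \<open>Operators replace matrices here because the norm of a \<open>blinfun\<close> is
    the operator norm, which is what \<open>bd\<close> controls.\<close>
  define B where "B = Blinfun (\<lambda>v. v - c *\<^sub>R (A *v v))"
  have B: "B v = v - c *\<^sub>R (A *v v)" for v
    unfolding B_def by (subst bounded_linear_Blinfun_apply)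
      (auto intro!: bounded_linear_sub bounded_linear_ident bounded_linear_const_scaleR)
  have nB: "norm B \<le> b"
  proof (rule norm_blinfun_bound[OF b(1)])
    fix v show "norm (B v) \<le> b * norm v"
      using real_sqrt_le_mono[OF bd[of v]] by (simp add: B b_def real_sqrt_mult)
  qed
  define S :: "((real^'d) \<Rightarrow>\<^sub>L (real^'d)) set"
    where "S = cball 0 b \<inter> (\<Inter>u. \<Inter>v. {Y. blinfun_apply Y u \<bullet> v = u \<bullet> Y v})"
  define f where "f Y = (1/2) *\<^sub>R (B + (Y o\<^sub>L Y))" for Y
  have "closed S" unfolding S_def
    by (intro closed_Int closed_cball closed_INT ballI closed_Collect_eq continuous_intros)
  hence "complete S" by (simp add: complete_eq_closed)
  moreover have "S \<noteq> {}"
  proof -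
    have "0 \<in> S" using b by (simp add: S_def)
    thus ?thesis by blast
  qed
  moreover have "f ` S \<subseteq> S"
  proof
    fix Z assume "Z \<in> f ` S"
    then obtain Y where Y: "norm Y \<le> b" "\<And>u v. blinfun_apply Y u \<bullet> v = u \<bullet> Y v" and Z: "Z = f Y"
      by (auto simp: S_def)
    have "norm (Y o\<^sub>L Y) \<le> b * 1"
      using b Y(1) by (intro order_trans[OF norm_blinfun_compose] mult_mono) auto
    hence "norm (B + (Y o\<^sub>L Y)) \<le> 2 * b" using nB norm_triangle_ineq[of B "Y o\<^sub>L Y"] by simp
    hence "norm Z \<le> b" by (simp add: Z f_def)
    moreover have "Z u \<bullet> v = u \<bullet> Z v" for u v
      using Y(2) A by (simp add: Z f_def B blinfun.scaleR_left blinfun.add_left inner_add inner_diff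
          pos_def_def sym_mat_inner_commute)
    ultimately show "Z \<in> S" by (simp add: S_def)
  qed
  moreover have "dist (f Y) (f Z) \<le> b * dist Y Z" if "Y \<in> S" "Z \<in> S" for Y Z
  proof -
    have n: "norm Y \<le> b" "norm Z \<le> b" using that by (auto simp: S_def)
    \<comment> \<open>Difference of squares for noncommuting factors: each of the two products
      contributes a factor \<open>b\<close>, and the \<open>1/2\<close> in \<open>f\<close> leaves
      the contraction constant \<open>b\<close>.\<close>
    have "f Y - f Z = (1/2) *\<^sub>R ((Y o\<^sub>L (Y - Z)) + ((Y - Z) o\<^sub>L Z))"
      by (rule blinfun_eqI) (simp add: f_def blinfun.bilinear_simps algebra_simps)
    moreover have "norm ((Y o\<^sub>L (Y - Z)) + ((Y - Z) o\<^sub>L Z)) \<le> b * norm (Y - Z) + norm (Y - Z) * b"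
      using n b by (intro order_trans[OF norm_triangle_ineq] add_mono order_trans[OF norm_blinfun_compose]
          mult_mono) auto
    ultimately show ?thesis by (simp add: dist_norm mult.commute)
  qed
  ultimately obtain Y where Y: "Y \<in> S" "f Y = Y" using Banach_fix[of S b f] b by blast
  have YY: "Y (Y v) = 2 *\<^sub>R Y v - v + c *\<^sub>R (A *v v)" for v
  proof -
    have "2 *\<^sub>R Y v = B v + Y (Y v)"
      using arg_cong[OF Y(2), of "\<lambda>Z. 2 *\<^sub>R blinfun_apply Z v"] by (simp add: f_def blinfun.bilinear_simps)
    thus ?thesis by (simp add: B algebra_simps)
  qed
  define L where "L = matrix (\<lambda>v. (1 / sqrt c) *\<^sub>R (v - Y v))"
  have L: "L *v v = (1 / sqrt c) *\<^sub>R (v - Y v)" for v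
  proof -
    have "linear (\<lambda>v. (1 / sqrt c) *\<^sub>R (v - Y v))"
      by (rule linearI) (simp_all add: blinfun.bilinear_simps algebra_simps)
    thus ?thesis by (simp add: L_def)
  qed
  show ?thesis
  proof (rule that)
    have "(L ** L) *v v = A *v v" for v
    proof -
      have "(L ** L) *v v = (1 / sqrt c * (1 / sqrt c)) *\<^sub>R (v - Y v - (Y v - Y (Y v)))"
        by (simp add: L blinfun.bilinear_simps algebra_simps flip: matrix_vector_mul_assoc)
      also have "v - Y v - (Y v - Y (Y v)) = c *\<^sub>R (A *v v)" by (simp add: YY scaleR_2)
      finally show ?thesis using c by simp
    qed
    thus "L ** L = A" by (simp add: matrix_eq)
    have "sym_mat L" using Y(1) by (intro sym_matI) (simp add: L S_def inner_diff)
    moreover have "v \<bullet> (L *v v) > 0" if "v \<noteq> 0" for v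
    proof -
      \<comment> \<open>Positivity of the identity minus \<open>Y\<close> comes from the bound
        \<open>b < 1\<close> on the norm of \<open>Y\<close>.\<close>
      have "v \<bullet> Y v \<le> norm v * (norm Y * norm v)"
        by (intro order_trans[OF norm_cauchy_schwarz] mult_left_mono norm_blinfun) auto
      also have "\<dots> \<le> norm v * (b * norm v)"
        using Y(1) by (intro mult_left_mono mult_right_mono) (auto simp: S_def)
      also have "\<dots> < v \<bullet> v" using b that by (simp add: dot_square_norm power2_eq_square)
      finally show ?thesis using c by (simp add: L inner_diff)
    qed
    ultimately show "pos_def L" by (simp add: pos_def_def)
  qed
qed

lemma pos_def_square:
  assumes "pos_def L" shows "pos_def (L ** L)"
proof -
  have "v \<bullet> (L ** L *v v) > 0" if "v \<noteq> 0" for v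
  proof -
    have "L *v v \<noteq> 0" using assms that by (metis inner_zero_right less_irrefl pos_def_def)
    moreover have "v \<bullet> (L ** L *v v) = (L *v v) \<bullet> (L *v v)"
      using assms by (simp add: pos_def_def sym_mat_inner_commute matrix_vector_mul_assoc)
    ultimately show ?thesis by simp
  qed
  thus ?thesis using pos_def_transpose[OF assms]
    by (simp add: pos_def_def sym_mat_def matrix_transpose_mul)
qed

section \<open>Symmetric units as test directions\<close>

lemma inner_sym_unit:
  fixes A :: "real^'d^'d"
  assumes "sym_mat A"
  shows "sym_unit i j \<bullet> A = (if i = j then 1 else 2) * A $ i $ j"
proof -
  have s: "A $ j $ i = A $ i $ j"
    using arg_cong[OF assms[unfolded sym_mat_def], of "\<lambda>A. A $ i $ j"] by (simp add: transpose_def)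
  have "sym_unit i j \<bullet> A = (\<Sum>(a, b)\<in>UNIV \<times> UNIV. sym_unit i j $ a $ b * A $ a $ b)"
    by (simp add: inner_mat_eq_sum sum.cartesian_product)
  also have "\<dots> = (\<Sum>(a, b)\<in>{(i, j), (j, i)}. sym_unit i j $ a $ b * A $ a $ b)"
    by (rule sum.mono_neutral_right) (auto simp: sym_unit_def split: if_splits)
  also have "\<dots> = (if i = j then 1 else 2) * A $ i $ j"
    using s by (cases "i = j") (auto simp: sym_unit_def)
  finally show ?thesis .
qed

text \<open>Combines all matrix directions of \<open>param_dirs\<close>. Since \<open>A\<close> has
  to be symmetric, the estimating equations are symmetrised before it is applied.\<close>

lemma sym_mat_eq_0_of_sym_unit:
  assumes "sym_mat A" "\<And>i j. sym_unit i j \<bullet> A = 0"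
  shows "A = 0"
  using assms(2) inner_sym_unit[OF assms(1)] by (simp add: vec_eq_iff) (metis zero_neq_numeral zero_neq_one)

section \<open>Integration by parts and gradients of divergence-free potentials\<close>

lemma lborel_integrable_translate:
  fixes f :: "'a::euclidean_space \<Rightarrow> real"
  assumes f: "integrable lborel f"
  shows "integrable lborel (\<lambda>x. f (c + x))"
  using integrable_distr[of "(+) c" lborel borel f] f by (simp add: lborel_distr_plus)

lemma lborel_integral_translate:
  fixes f :: "'a::euclidean_space \<Rightarrow> real"
  assumes "f \<in> borel_measurable borel"
  shows "(\<integral>x. f (c + x) \<partial>lborel) = (\<integral>x. f x \<partial>lborel)"
  using integral_distr[of "(+) c" lborel borel f] assms by (simp add: lborel_distr_plus)

text \<open>Integrating \<open>\<phi> (y + h) - \<phi> y = \<integral>\<^sub>0\<^sup>1 \<phi>' (y + t h) h dt\<close> over \<open>y\<close>, translation invariance makes the left side vanish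
  and turns the right side into \<open>\<integral> \<phi>' y h dy\<close>.\<close>

lemma integral_directional_derivative_eq_0:
  fixes \<phi> :: "'a::euclidean_space \<Rightarrow> real"
  assumes der: "\<And>y. (\<phi> has_derivative \<phi>' y) (at y)"
    and cont: "continuous_on UNIV (\<lambda>y. \<phi>' y h)"
    and int: "integrable lborel \<phi>" and int': "integrable lborel (\<lambda>y. \<phi>' y h)"
  shows "(\<integral>y. \<phi>' y h \<partial>lborel) = 0"
proof -
  define g where "g y = \<phi>' y h" for y
  have cg: "continuous_on UNIV g" using cont by (simp add: g_def[abs_def])
  hence g[measurable]: "g \<in> borel_measurable borel" by (rule borel_measurable_continuous_onI)
  have c\<phi>: "continuous_on UNIV \<phi>"
    using der by (intro continuous_at_imp_continuous_on ballI) (blast intro: has_derivative_continuous)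
  have m\<phi>[measurable]: "\<phi> \<in> borel_measurable borel"
    by (rule borel_measurable_continuous_onI[OF c\<phi>])
  have ig: "integrable lborel g" using int' by (simp add: g_def[abs_def])
  have igt: "integrable lborel (\<lambda>y. g (y + c))" for c
    using lborel_integrable_translate[OF ig, of c] by (simp add: add.commute)
  have tr: "(\<integral>y. f (y + c) \<partial>lborel) = (\<integral>y. f y \<partial>lborel)"
    if "f \<in> borel_measurable borel" for f :: "'a \<Rightarrow> real" and c
    using lborel_integral_translate[OF that, of c] by (simp add: add.commute)
  let ?I = "indicator {0..1} :: real \<Rightarrow> real"
  let ?F = "\<lambda>t y. g (y + t *\<^sub>R h) * ?I t"
  \<comment> \<open>By translation invariance every slice with \<open>t\<close> in the unit interval
    has the same L1 norm as \<open>g\<close>, so the iterated integral is finite.\<close>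
  have "integrable (lborel \<Otimes>\<^sub>M lborel) (case_prod ?F)"
  proof (rule lborel_pair.Fubini_integrable)
    show "case_prod ?F \<in> borel_measurable (lborel \<Otimes>\<^sub>M lborel)" by measurable
    have "(\<integral>y. norm (?F t y) \<partial>lborel) = ?I t *\<^sub>R (\<integral>y. norm (g y) \<partial>lborel)" for t
      using tr[of "\<lambda>y. norm (g y)" "t *\<^sub>R h"] by (simp add: abs_mult)
    thus "integrable lborel (\<lambda>t. \<integral>y. norm (case_prod ?F (t, y)) \<partial>lborel)"
      using borel_integrable_compact[of "{0..1::real}" "\<lambda>_. \<integral>y. norm (g y) \<partial>lborel"] by simp
    show "AE t in lborel. integrable lborel (\<lambda>y. case_prod ?F (t, y))"
      using igt by simp
  qed
  hence fubini: "(\<integral>y. (\<integral>t. ?F t y \<partial>lborel) \<partial>lborel) = (\<integral>t. (\<integral>y. ?F t y \<partial>lborel) \<partial>lborel)"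
    by (rule lborel_pair.Fubini_integral)
  have inner_y: "(\<integral>y. ?F t y \<partial>lborel) = ?I t * (\<integral>y. g y \<partial>lborel)" for t
    using tr[OF g] by simp
  have inner_t: "(\<integral>t. ?F t y \<partial>lborel) = \<phi> (y + h) - \<phi> y" for y
  proof -
    have lin: "linear (\<phi>' z)" for z using der has_derivative_linear by blast
    have "DERIV (\<lambda>t. \<phi> (y + t *\<^sub>R h)) t :> g (y + t *\<^sub>R h)" for t
    proof -
      have "((\<lambda>t. \<phi> (y + t *\<^sub>R h)) has_derivative (\<lambda>s. \<phi>' (y + t *\<^sub>R h) (s *\<^sub>R h))) (at t)"
        by (rule has_derivative_compose[OF _ der]) (auto intro!: derivative_eq_intros)
      thus ?thesis
        by (simp add: has_field_derivative_def g_def linear_scale[OF lin] mult_commute_abs)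
    qed
    moreover have "isCont (\<lambda>t. g (y + t *\<^sub>R h)) t" for t
      using cg by (intro continuous_on_interior[of UNIV] continuous_on_compose2[OF cg] continuous_intros) auto
    ultimately show ?thesis
      using integral_FTC_Icc_real[of 0 1 "\<lambda>t. \<phi> (y + t *\<^sub>R h)" "\<lambda>t. g (y + t *\<^sub>R h)"] by simp
  qed
  have "(\<integral>y. \<phi> (y + h) - \<phi> y \<partial>lborel) = (\<integral>t. ?I t * (\<integral>y. g y \<partial>lborel) \<partial>lborel)"
    using fubini by (simp only: inner_y inner_t)
  moreover have "(\<integral>y. \<phi> (y + h) - \<phi> y \<partial>lborel) = 0"
    using lborel_integrable_translate[OF int, of h] int tr[OF m\<phi>, of h] by (simp add: add.commute)
  ultimately have "(\<integral>y. g y \<partial>lborel) = 0" by simp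
  thus ?thesis by (simp add: g_def)
qed

lemma integrable_continuous_compact_support:
  fixes f :: "'a::euclidean_space \<Rightarrow> real"
  assumes "continuous_on UNIV f" "compact S" "\<And>y. y \<notin> S \<Longrightarrow> f y = 0"
  shows "integrable lborel f"
proof -
  have "integrable lborel (\<lambda>y. indicator S y *\<^sub>R f y)"
    using assms by (intro borel_integrable_compact continuous_on_subset[OF assms(1)]) auto
  moreover have "(\<lambda>y. indicator S y *\<^sub>R f y) = f"
    using assms(3) by (force simp: indicator_def)
  ultimately show ?thesis by simp
qed

text \<open>The set where \<open>f\<close> is nonzero is open and null, hence empty. Passing to
  \<open>lebesgue\<close> links the null set with \<open>negligible\<close>, which refers to the
  completed measure.\<close>

lemma continuous_nonneg_integral_0_imp_0:
  fixes f :: "'a::euclidean_space \<Rightarrow> real"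
  assumes cont: "continuous_on UNIV f" and nn: "\<And>y. 0 \<le> f y"
    and int: "integrable lborel f" and 0: "(\<integral>y. f y \<partial>lborel) = 0"
  shows "f y = 0"
proof (rule ccontr)
  assume "f y \<noteq> 0"
  have "AE y in lborel. f y = 0" using 0 int nn by (subst (asm) integral_nonneg_eq_0_iff_AE) auto
  hence "AE y in lebesgue. f y = 0" by (rule AE_completion)
  hence "negligible {y. f y \<noteq> 0}"
    by (simp add: negligible_iff_null_sets AE_iff_null_sets eventually_ae_filter) 
       (metis (mono_tags, lifting) completion.complete2)
  moreover have "open {y. f y \<noteq> 0}" using cont by (intro open_Collect_neq) auto
  ultimately show False using open_not_negligible \<open>f y \<noteq> 0\<close> by blast
qed

section \<open>A continuously differentiable cutoff\<close>

lemma DERIV_max_0_square: "DERIV (\<lambda>s::real. (max 0 s)\<^sup>2) s :> 2 * max 0 s"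
proof -
  consider "s > 0" | "s < 0" | "s = 0" by linarith
  thus ?thesis
  proof cases
    case 1
    have "DERIV (\<lambda>s::real. s\<^sup>2) s :> 2 * max 0 s" using 1 by (auto intro!: derivative_eq_intros)
    thus ?thesis
      by (rule has_field_derivative_transform_within_open[where S = "{0<..}"]) (use 1 in auto)
  next
    case 2
    have "DERIV (\<lambda>s::real. 0) s :> 2 * max 0 s" using 2 by simp
    thus ?thesis
      by (rule has_field_derivative_transform_within_open[where S = "{..<0}"]) (use 2 in auto)
  next
    case 3
    \<comment> \<open>At the kink the difference quotient is at most the absolute value of
      \<open>h\<close>: squaring the positive part removes the corner.\<close>
    have "((\<lambda>h. (max 0 h)\<^sup>2 / h) \<longlongrightarrow> 0) (at (0::real))"
    proof (rule Lim_null_comparison)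
      show "\<forall>\<^sub>F h in at (0::real). norm ((max 0 h)\<^sup>2 / h) \<le> \<bar>h\<bar>"
        by (rule always_eventually) (auto simp: max_def power2_eq_square)
      show "((\<lambda>h. \<bar>h\<bar>) \<longlongrightarrow> 0) (at (0::real))" by (rule tendsto_rabs_zero[OF tendsto_ident_at])
    qed
    thus ?thesis using 3 by (simp add: DERIV_def)
  qed
qed

text \<open>For positive \<open>R\<close> it is supported in the ball of radius \<open>R\<close>,
  and it is C^1 across the boundary because the positive part is squared. The integration by parts
  differentiates it only once.\<close>

definition cutoff :: "real \<Rightarrow> 'a::euclidean_space \<Rightarrow> real" where
  "cutoff R y = (max 0 (1 - (norm y)\<^sup>2 / R\<^sup>2))\<^sup>2"

definition cutoff_grad :: "real \<Rightarrow> 'a::euclidean_space \<Rightarrow> 'a" where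
  "cutoff_grad R y = (- 4 * max 0 (1 - (norm y)\<^sup>2 / R\<^sup>2) / R\<^sup>2) *\<^sub>R y"

lemma cutoff_has_derivative: "(cutoff R has_derivative (\<lambda>h. cutoff_grad R y \<bullet> h)) (at y)"
proof -
  have "((\<lambda>y. 1 - (norm y)\<^sup>2 / R\<^sup>2) has_derivative (\<lambda>h. - 2 * (y \<bullet> h) / R\<^sup>2)) (at y)"
    unfolding power2_norm_eq_inner divide_inverse
    by (auto intro!: derivative_eq_intros simp: inner_commute algebra_simps)
  from DERIV_compose_FDERIV[OF DERIV_max_0_square this] show ?thesis
    unfolding cutoff_def[abs_def] cutoff_grad_def by (simp add: mult_ac)
qed

lemma continuous_on_cutoff: "continuous_on S (cutoff R)"
  unfolding cutoff_def[abs_def] divide_inverse by (intro continuous_intros)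

lemma continuous_on_cutoff_grad: "continuous_on S (cutoff_grad R)"
  unfolding cutoff_grad_def[abs_def] divide_inverse by (intro continuous_intros)

lemma cutoff_outside: "R > 0 \<Longrightarrow> y \<notin> cball 0 R \<Longrightarrow> cutoff R y = 0 \<and> cutoff_grad R y = 0"
  by (auto simp: cutoff_def cutoff_grad_def field_simps max_def power_mono dest!: power_strict_mono[of R _ 2])

lemma cutoff_nonneg: "0 \<le> cutoff R y"
  by (simp add: cutoff_def)

lemma cutoff_le_1: "cutoff R y \<le> 1"
  unfolding cutoff_def by (rule power_le_one) auto

text \<open>On the support \<open>norm y\<close> is at most \<open>R\<close>, which cancels one
  power of \<open>R\<close>. The remaining decay makes the error term of the energy estimate vanish
  in the limit.\<close>

lemma norm_cutoff_grad_le: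
  fixes y :: "'a::euclidean_space"
  assumes "R > 0" shows "norm (cutoff_grad R y) \<le> 4 / R"
proof (cases "y \<in> cball 0 R")
  case True
  have "norm (cutoff_grad R y) = 4 * max 0 (1 - (norm y)\<^sup>2 / R\<^sup>2) * norm y / R\<^sup>2"
    by (simp add: cutoff_grad_def abs_mult)
  also have "\<dots> \<le> 4 * 1 * R / R\<^sup>2"
    using True assms by (intro divide_right_mono mult_mono) auto
  also have "\<dots> = 4 / R" using assms by (simp add: power2_eq_square)
  finally show ?thesis .
next
  case False
  with cutoff_outside[OF assms False] assms show ?thesis by simp
qed

lemma cutoff_tendsto: "(\<lambda>n. cutoff (real n) y) \<longlonglongrightarrow> 1"
proof -
  have "(\<lambda>n. (norm y)\<^sup>2 / (real n)\<^sup>2) \<longlonglongrightarrow> 0"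
    by (intro tendsto_divide_0[OF tendsto_const] filterlim_at_top_imp_at_infinity
        filterlim_pow_at_top filterlim_real_sequentially) auto
  hence "(\<lambda>n. cutoff (real n) y) \<longlonglongrightarrow> (max 0 (1 - 0))\<^sup>2"
    unfolding cutoff_def by (intro tendsto_intros)
  thus ?thesis by simp
qed

section \<open>Weighted divergence and the energy estimate\<close>

lemma inner_axis_1: "(v::real^'d) \<bullet> axis i 1 = v $ i"
  by (simp add: inner_axis)

lemma divergence_eq:
  assumes "(F has_derivative F') (at y)"
  shows "divergence F y = (\<Sum>i\<in>UNIV. F' (axis i 1) $ i)"
  using frechet_derivative_at[OF assms] by (simp add: divergence_def)

lemma has_derivative_scaleR_field:
  fixes p :: "real^'d \<Rightarrow> real" and G :: "real^'d \<Rightarrow> real^'d"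
  assumes "(p has_derivative p') (at y)" "(G has_derivative G') (at y)"
  shows "((\<lambda>z. p z *\<^sub>R G z) has_derivative (\<lambda>h. p' h *\<^sub>R G y + p y *\<^sub>R G' h)) (at y)"
  using has_derivative_scaleR[OF assms] by (simp add: add.commute)

lemma divergence_scaleR_diff:
  fixes p :: "real^'d \<Rightarrow> real"
  assumes p: "(p has_derivative p') (at y)"
    and G: "(G has_derivative G') (at y)" and K: "(K has_derivative K') (at y)"
  shows "divergence (\<lambda>z. p z *\<^sub>R (G z - K z)) y
    = divergence (\<lambda>z. p z *\<^sub>R G z) y - divergence (\<lambda>z. p z *\<^sub>R K z) y"
  using divergence_eq[OF has_derivative_scaleR_field[OF p has_derivative_diff[OF G K]]]
    divergence_eq[OF has_derivative_scaleR_field[OF p G]]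
    divergence_eq[OF has_derivative_scaleR_field[OF p K]]
  by (simp add: sum_subtractf[symmetric] algebra_simps)

text \<open>Testing \<open>div (p \<nabla>D) = 0\<close> against \<open>\<chi> D\<close> gives \<open>\<integral> \<chi> p |\<nabla>D|\<^sup>2 = - \<integral> p D \<nabla>\<chi> \<bullet> \<nabla>D\<close>, which is at most
  \<open>(2 / R) \<integral> p (D\<^sup>2 + |\<nabla>D|\<^sup>2)\<close> for the cutoff \<open>\<chi>\<close> of radius \<open>R\<close>.\<close>

lemma divergence_free_gradient_eq_0:
  fixes p D :: "real^'d \<Rightarrow> real" and G :: "real^'d \<Rightarrow> real^'d"
  assumes p: "\<And>y. (p has_derivative p' y) (at y)" "\<And>h. continuous_on UNIV (\<lambda>y. p' y h)"
    and p_pos: "\<And>y. p y > 0"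
    and D: "\<And>y. (D has_derivative (\<lambda>h. G y \<bullet> h)) (at y)"
    and G: "\<And>y. (G has_derivative G' y) (at y)" "\<And>h. continuous_on UNIV (\<lambda>y. G' y h)"
    and div0: "\<And>y. divergence (\<lambda>z. p z *\<^sub>R G z) y = 0"
    and intD: "integrable lborel (\<lambda>y. p y * (D y)\<^sup>2)"
    and intG: "integrable lborel (\<lambda>y. p y * (norm (G y))\<^sup>2)"
  shows "G y = 0"
proof -
  have cont: "continuous_on UNIV p" "continuous_on UNIV D" "continuous_on UNIV G"
    using p(1) D G(1)
    by (auto intro!: continuous_at_imp_continuous_on has_derivative_continuous)
  define W where "W y = p y *\<^sub>R G y" for y
  define W' where "W' y h = p' y h *\<^sub>R G y + p y *\<^sub>R G' y h" for y h
  have W: "(W has_derivative W' y) (at y)" for y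
    unfolding W_def[abs_def] W'_def by (rule has_derivative_scaleR_field[OF p(1) G(1)])
  have cW: "continuous_on UNIV W" "continuous_on UNIV (\<lambda>y. W' y h)" for h
    unfolding W_def[abs_def] W'_def by (intro continuous_intros cont p G)+
  have divW: "(\<Sum>i\<in>UNIV. W' y (axis i 1) $ i) = 0" for y
    using div0[of y] divergence_eq[OF W] by (simp add: W_def[abs_def])
  define C where "C = (\<integral>y. p y * (D y)\<^sup>2 + p y * (norm (G y))\<^sup>2 \<partial>lborel)"
  have bound: "(\<integral>y. cutoff R y * (p y * (norm (G y))\<^sup>2) \<partial>lborel) \<le> 2 / R * C" if R: "R > 0" for R
  proof -
    \<comment> \<open>The components of the field cutoff times \<open>D\<close> times
      \<open>W\<close>. Each has compact support, so its derivative along its own axis integrates to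
      zero; the sum over \<open>i\<close> of these derivatives is the divergence of the
      field.\<close>
    define \<phi> where "\<phi> i y = cutoff R y * D y * W y $ i" for i y
    define \<phi>' where "\<phi>' i y h = (cutoff_grad R y \<bullet> h * D y + cutoff R y * (G y \<bullet> h)) * W y $ i
        + cutoff R y * D y * W' y h $ i" for i y h
    have \<phi>: "(\<phi> i has_derivative \<phi>' i y) (at y)" for i y
      unfolding \<phi>_def[abs_def] \<phi>'_def
      by (rule derivative_eq_intros cutoff_has_derivative D bounded_linear.has_derivative[OF bounded_linear_vec_nth W] refl)+
        (simp add: algebra_simps)
    have c\<phi>': "continuous_on UNIV (\<lambda>y. \<phi>' i y h)" and c\<phi>: "continuous_on UNIV (\<phi> i)" for i h
      unfolding \<phi>_def[abs_def] \<phi>'_def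
      by (intro continuous_intros continuous_on_cutoff continuous_on_cutoff_grad cont cW)+
    have i\<phi>': "integrable lborel (\<lambda>y. \<phi>' i y h)" and i\<phi>: "integrable lborel (\<phi> i)" for i h
      by (rule integrable_continuous_compact_support[OF c\<phi>' compact_cball[of 0 R]],
          simp add: \<phi>'_def cutoff_outside[OF R] del: mem_cball,
          rule integrable_continuous_compact_support[OF c\<phi> compact_cball[of 0 R]],
          simp add: \<phi>_def cutoff_outside[OF R] del: mem_cball)
    have "(\<integral>y. \<phi>' i y (axis i 1) \<partial>lborel) = 0" for i
      by (rule integral_directional_derivative_eq_0[OF \<phi> c\<phi>' i\<phi> i\<phi>'])
    hence "(\<integral>y. (\<Sum>i\<in>UNIV. \<phi>' i y (axis i 1)) \<partial>lborel) = 0"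
      by (subst Bochner_Integration.integral_sum) (auto intro: i\<phi>')
    moreover have "(\<Sum>i\<in>UNIV. \<phi>' i y (axis i 1)) = 
      (cutoff_grad R y \<bullet> W y) * D y + cutoff R y * (p y * (norm (G y))\<^sup>2)" for y
    proof -
      \<comment> \<open>Product rule: the derivative falls on the cutoff, on \<open>D\<close> or on
        \<open>W\<close>; the last sum is the divergence of \<open>W\<close>, which is zero by
        \<open>divW\<close>.\<close>
      have "(\<Sum>i\<in>UNIV. \<phi>' i y (axis i 1)) = (\<Sum>i\<in>UNIV. cutoff_grad R y $ i * W y $ i) * D y
        + cutoff R y * (\<Sum>i\<in>UNIV. G y $ i * W y $ i) + cutoff R y * D y * (\<Sum>i\<in>UNIV. W' y (axis i 1) $ i)"
        unfolding sum_distrib_left sum_distrib_right sum.distrib[symmetric]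
        by (intro sum.cong refl) (simp add: \<phi>'_def inner_axis_1 algebra_simps)
      also have "(\<Sum>i\<in>UNIV. G y $ i * W y $ i) = p y * (norm (G y))\<^sup>2"
        by (simp add: W_def power2_norm_eq_inner inner_vec_def sum_distrib_left mult_ac)
      also have "(\<Sum>i\<in>UNIV. cutoff_grad R y $ i * W y $ i) = cutoff_grad R y \<bullet> W y"
        by (simp add: inner_vec_def)
      finally show ?thesis by (simp add: divW)
    qed
    ultimately have eq: "(\<integral>y. (cutoff_grad R y \<bullet> W y) * D y + cutoff R y * (p y * (norm (G y))\<^sup>2) \<partial>lborel) = 0"
      by simp
    have i1: "integrable lborel (\<lambda>y. (cutoff_grad R y \<bullet> W y) * D y)"
      by (rule integrable_continuous_compact_support[OF _ compact_cball[of 0 R]],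
          intro continuous_intros continuous_on_cutoff_grad cont cW,
          simp add: cutoff_outside[OF R] del: mem_cball)
    have i2: "integrable lborel (\<lambda>y. cutoff R y * (p y * (norm (G y))\<^sup>2))"
      by (rule integrable_continuous_compact_support[OF _ compact_cball[of 0 R]],
          intro continuous_intros continuous_on_cutoff cont,
          simp add: cutoff_outside[OF R] del: mem_cball)
    have "(\<integral>y. cutoff R y * (p y * (norm (G y))\<^sup>2) \<partial>lborel) = (\<integral>y. - ((cutoff_grad R y \<bullet> W y) * D y) \<partial>lborel)"
      using eq by (simp add: Bochner_Integration.integral_add[OF i1 i2])
    also have "\<dots> \<le> (\<integral>y. 2 / R * (p y * (D y)\<^sup>2 + p y * (norm (G y))\<^sup>2) \<partial>lborel)"
    proof (rule integral_mono)
      fix y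
      have "- ((cutoff_grad R y \<bullet> W y) * D y) \<le> \<bar>cutoff_grad R y \<bullet> W y\<bar> * \<bar>D y\<bar>"
        by (metis abs_ge_minus_self abs_mult)
      also have "\<dots> \<le> (4 / R * (p y * norm (G y))) * \<bar>D y\<bar>"
        using p_pos[of y] R norm_cutoff_grad_le[OF R, of y]
        by (intro mult_right_mono order_trans[OF Cauchy_Schwarz_ineq2] mult_mono) (auto simp: W_def)
      \<comment> \<open>Regrouped for the inequality \<open>2 * a * b \<le> a^2 + b^2\<close>, which
        is how the gradient bound \<open>4 / R\<close> turns into the factor
        \<open>2 / R\<close>.\<close>
      also have "\<dots> = 2 / R * p y * (2 * \<bar>D y\<bar> * norm (G y))" by simp
      also have "\<dots> \<le> 2 / R * p y * (\<bar>D y\<bar>\<^sup>2 + (norm (G y))\<^sup>2)"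
        using p_pos[of y] R by (intro mult_left_mono sum_squares_bound) auto
      finally show "- ((cutoff_grad R y \<bullet> W y) * D y) \<le> 2 / R * (p y * (D y)\<^sup>2 + p y * (norm (G y))\<^sup>2)"
        by (simp add: algebra_simps)
    qed (use i1 intD intG in auto)
    also have "\<dots> = 2 / R * C" unfolding C_def by (rule Bochner_Integration.integral_mult_right_zero)
    finally show ?thesis .
  qed
  let ?g = "\<lambda>y. p y * (norm (G y))\<^sup>2"
  have cg: "continuous_on UNIV ?g" by (intro continuous_intros cont)
  have gnn: "0 \<le> ?g y" for y using p_pos[of y] by simp
  have "(\<lambda>n. \<integral>y. cutoff (real n) y * ?g y \<partial>lborel) \<longlonglongrightarrow> (\<integral>y. ?g y \<partial>lborel)"
  proof (rule integral_dominated_convergence[where w = ?g])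
    show "AE y in lborel. (\<lambda>n. cutoff (real n) y * ?g y) \<longlonglongrightarrow> ?g y"
      using tendsto_mult_right[OF cutoff_tendsto] by (intro always_eventually) auto
    show "AE y in lborel. norm (cutoff (real n) y * ?g y) \<le> ?g y" for n
    proof (intro always_eventually allI)
      fix y
      have "norm (cutoff (real n) y * ?g y) = cutoff (real n) y * ?g y"
        unfolding real_norm_def by (intro abs_of_nonneg mult_nonneg_nonneg cutoff_nonneg gnn)
      also have "\<dots> \<le> ?g y" by (intro mult_left_le_one_le gnn cutoff_nonneg cutoff_le_1)
      finally show "norm (cutoff (real n) y * ?g y) \<le> ?g y" .
    qed
    show "(\<lambda>y. cutoff (real n) y * ?g y) \<in> borel_measurable lborel" for n
      by simp (intro borel_measurable_continuous_onI continuous_on_mult continuous_on_cutoff cg)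
  qed (use intG in auto)
  moreover have "(\<lambda>n. 2 / real n * C) \<longlonglongrightarrow> 0"
    by (intro tendsto_mult_left_zero tendsto_divide_0[OF tendsto_const]
        filterlim_at_top_imp_at_infinity filterlim_real_sequentially)
  \<comment> \<open>\<open>bound\<close> asks for a positive radius, so the two sequences are
    compared from index 1 on.\<close>
  ultimately have "(\<integral>y. ?g y \<partial>lborel) \<le> 0"
    by (rule LIMSEQ_le) (use bound in \<open>auto intro!: exI[of _ 1]\<close>)
  moreover have "0 \<le> (\<integral>y. ?g y \<partial>lborel)" using gnn by (intro Bochner_Integration.integral_nonneg) auto
  ultimately have "(\<integral>y. ?g y \<partial>lborel) = 0" by simp
  from continuous_nonneg_integral_0_imp_0[OF cg gnn intG this, of y] show ?thesis
    using p_pos[of y] by simp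
qed

lemma derivative_zero_imp_constant:
  fixes D :: "'a::real_normed_vector \<Rightarrow> real"
  assumes "\<And>y. (D has_derivative (\<lambda>h. 0)) (at y)"
  shows "D y = D z"
  using has_derivative_zero_constant[OF convex_UNIV, of D] assms by (metis UNIV_I)

section \<open>The Gaussian model and its scores\<close>

lemma integrable_exp_neg_square:
  fixes c :: real
  assumes "c > 0"
  shows "integrable lborel (\<lambda>x::real. exp (- c * x\<^sup>2))"
proof -
  define \<sigma> where "\<sigma> = sqrt (1 / (2 * c))"
  have \<sigma>: "\<sigma> > 0" "2 * \<sigma>\<^sup>2 = 1 / c" using assms by (simp_all add: \<sigma>_def)
  have "integrable lborel (\<lambda>x. sqrt (2 * pi * \<sigma>\<^sup>2) * normal_density 0 \<sigma> x)"
    using \<sigma> by (intro integrable_mult_right integrable_normal_density) auto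
  moreover have "sqrt (2 * pi * \<sigma>\<^sup>2) * normal_density 0 \<sigma> x = exp (- c * x\<^sup>2)" for x
    using \<sigma> by (simp add: normal_density_def mult.commute)
  ultimately show ?thesis by simp
qed

text \<open>The integrand is a product of one-dimensional Gaussians over the coordinates; with
  nonnegative integrals the factorisation yields finiteness directly.\<close>

lemma integrable_exp_neg_norm_square:
  assumes c: "c > 0"
  shows "integrable lborel (\<lambda>y::'a::euclidean_space. exp (- c * (norm y)\<^sup>2))"
proof (rule integrableI_nonneg)
  have "exp (- c * (norm y)\<^sup>2) = (\<Prod>b\<in>Basis. exp (- c * (y \<bullet> b)\<^sup>2))" for y :: 'a
    unfolding power2_norm_eq_inner euclidean_inner[of y y]
    by (simp add: exp_sum sum_distrib_left power2_eq_square flip: sum_negf)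
  hence "(\<integral>\<^sup>+y. ennreal (exp (- c * (norm y)\<^sup>2)) \<partial>(lborel :: 'a measure))
     = (\<integral>\<^sup>+y. (\<Prod>b\<in>Basis. ennreal (exp (- c * (y \<bullet> b)\<^sup>2))) \<partial>(lborel :: 'a measure))"
    by (simp add: prod_ennreal)
  also have "\<dots> = (\<Prod>b\<in>(Basis::'a set). (\<integral>\<^sup>+x. ennreal (exp (- c * x\<^sup>2)) \<partial>lborel))"
    by (rule nn_integral_lborel_prod) auto
  also have "(\<integral>\<^sup>+x. ennreal (exp (- c * x\<^sup>2)) \<partial>lborel) = ennreal (\<integral>x. exp (- c * x\<^sup>2) \<partial>lborel)"
    by (rule nn_integral_eq_integral[OF integrable_exp_neg_square[OF c]]) auto
  also have "(\<Prod>b\<in>(Basis::'a set). ennreal (\<integral>x. exp (- c * x\<^sup>2) \<partial>lborel)) < \<infinity>"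
    by (simp add: ennreal_power less_top[symmetric])
  finally show "(\<integral>\<^sup>+y. ennreal (exp (- c * (norm y)\<^sup>2)) \<partial>(lborel :: 'a measure)) < \<infinity>" .
qed auto

text \<open>Jacobi's formula at the identity, read off the Leibniz expansion: a permutation other
  than \<open>id\<close> moves at least two indices, so after one factor is differentiated an
  off-diagonal entry of the identity still multiplies the term.\<close>

lemma DERIV_det_at_mat_1:
  fixes M :: "real^'d^'d"
  shows "DERIV (\<lambda>t. det (mat 1 + t *\<^sub>R M)) 0 :> trace M"
proof -
  let ?f = "\<lambda>p i t. (mat 1 :: real^'d^'d) $ i $ p i + t * M $ i $ p i"
  have "DERIV (\<lambda>t. \<Sum>p | p permutes UNIV. of_int (sign p) * (\<Prod>i\<in>UNIV. ?f p i t)) 0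
    :> (\<Sum>p | p permutes UNIV. of_int (sign p) * (\<Sum>i\<in>UNIV. M $ i $ p i * (\<Prod>j\<in>UNIV - {i}. ?f p j 0)))"
    by (intro DERIV_sum DERIV_cmult has_field_derivative_prod) (auto intro!: derivative_eq_intros)
  moreover have "(\<Sum>p | p permutes UNIV. of_int (sign p) * (\<Sum>i\<in>UNIV. M $ i $ p i * (\<Prod>j\<in>UNIV - {i}. ?f p j 0)))
     = (\<Sum>p\<in>{id}. of_int (sign p) * (\<Sum>i\<in>UNIV. M $ i $ p i * (\<Prod>j\<in>UNIV - {i}. ?f p j 0)))"
  proof (rule sum.mono_neutral_right)
    show "\<forall>p\<in>{p. p permutes UNIV} - {id}.
       of_int (sign p) * (\<Sum>i\<in>UNIV. M $ i $ p i * (\<Prod>j\<in>UNIV - {i}. ?f p j 0)) = 0"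
    proof
      fix p :: "'d \<Rightarrow> 'd" assume p: "p \<in> {p. p permutes UNIV} - {id}"
      then obtain k where k: "p k \<noteq> k" by (auto simp: fun_eq_iff)
      have "p (p k) \<noteq> p k" using k p permutes_inj[of p UNIV] by (auto dest: injD)
      have "(\<Prod>j\<in>UNIV - {i}. ?f p j 0) = 0" for i
      proof -
        \<comment> \<open>Both \<open>k\<close> and \<open>p k\<close> are moved and they are
          distinct, so one of them differs from \<open>i\<close>.\<close>
        obtain j where "j \<noteq> i" "p j \<noteq> j" using k \<open>p (p k) \<noteq> p k\<close> by metis
        thus ?thesis by (intro prod_zero) (auto simp: mat_def intro!: bexI[of _ j])
      qed
      thus "of_int (sign p) * (\<Sum>i\<in>UNIV. M $ i $ p i * (\<Prod>j\<in>UNIV - {i}. ?f p j 0)) = 0"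
        by (simp only: mult_zero_right sum.neutral_const)
    qed
  qed (auto simp: permutes_id)
  moreover have "\<dots> = trace M" by (simp add: trace_def mat_def sign_id)
  ultimately show ?thesis by (simp add: det_def)
qed

lemma trace_eq_inner: "trace (M::real^'d^'d) = mat 1 \<bullet> M"
  by (simp add: trace_def inner_mat_eq_sum mat_def if_distrib[of "\<lambda>x. x * _"] cong: if_cong)

lemma DERIV_abs_pos: "(f has_real_derivative D) (at x) \<Longrightarrow> f x > 0 \<Longrightarrow> ((\<lambda>x. \<bar>f x\<bar>) has_real_derivative D) (at x)"
proof -
  assume f: "(f has_real_derivative D) (at x)" "f x > 0"
  have "DERIV (\<lambda>s. \<bar>s\<bar>) (f x) :> 1"
    by (rule has_field_derivative_transform_within_open[OF DERIV_ident, where S = "{0<..}"]) (use f in auto)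
  from DERIV_chain2[OF this f(1)] show ?thesis by simp
qed

text \<open>Degrees add under products, so the integrability conditions of \<open>w_score\<close>
  become a degree count. The base \<open>1 + norm (y - m)\<close> is at least 1, which makes the
  class increasing in \<open>k\<close>.\<close>

definition grows :: "'a::real_normed_vector \<Rightarrow> nat \<Rightarrow> ('a \<Rightarrow> 'b::real_normed_vector) \<Rightarrow> bool" where
  "grows m k f \<longleftrightarrow> continuous_on UNIV f \<and> (\<exists>C\<ge>0. \<forall>y. norm (f y) \<le> C * (1 + norm (y - m)) ^ k)"

lemma grows_mono:
  assumes "grows m j f" "j \<le> k" shows "grows m k f"
proof -
  obtain C where C: "continuous_on UNIV f" "C \<ge> 0" "\<And>y. norm (f y) \<le> C * (1 + norm (y - m)) ^ j"
    using assms(1) by (auto simp: grows_def)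
  have "norm (f y) \<le> C * (1 + norm (y - m)) ^ k" for y
    using C(2) assms(2) by (intro order_trans[OF C(3)] mult_left_mono power_increasing) auto
  thus ?thesis using C by (auto simp: grows_def)
qed

lemma grows_const: "grows m k (\<lambda>y. c)"
proof -
  have "norm c * 1 \<le> norm c * (1 + norm (y - m)) ^ k" for y
    by (intro mult_left_mono one_le_power) auto
  thus ?thesis by (auto simp: grows_def intro!: exI[of _ "norm c"])
qed

lemma grows_linear:
  assumes "bounded_linear f" shows "grows m 1 (\<lambda>y. f (y - m))"
proof -
  obtain K where K: "K > 0" "\<And>x. norm (f x) \<le> norm x * K"
    using bounded_linear.pos_bounded[OF assms] by blast
  have "norm (f (y - m)) \<le> K * (1 + norm (y - m)) ^ 1" for y
    using K(2)[of "y - m"] K(1) by (simp add: algebra_simps)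
  moreover have "continuous_on UNIV (\<lambda>y. f (y - m))"
    by (rule continuous_on_compose2[OF linear_continuous_on[OF assms, of UNIV]]) (intro continuous_intros, simp)
  ultimately show ?thesis using K(1) by (auto simp: grows_def intro!: exI[of _ K])
qed

lemma grows_add:
  assumes "grows m k f" "grows m k g" shows "grows m k (\<lambda>y. f y + g y)"
proof -
  obtain C where C: "continuous_on UNIV f" "C \<ge> 0" "\<And>y. norm (f y) \<le> C * (1 + norm (y - m)) ^ k"
    using assms(1) by (auto simp: grows_def)
  obtain E where E: "continuous_on UNIV g" "E \<ge> 0" "\<And>y. norm (g y) \<le> E * (1 + norm (y - m)) ^ k"
    using assms(2) by (auto simp: grows_def)
  have "norm (f y + g y) \<le> (C + E) * (1 + norm (y - m)) ^ k" for y
    using C(3)[of y] E(3)[of y] norm_triangle_ineq[of "f y" "g y"] by (simp add: algebra_simps)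
  thus ?thesis using C E by (auto simp: grows_def intro!: continuous_intros exI[of _ "C + E"])
qed

lemma (in bounded_bilinear) grows_prod:
  assumes "grows m j f" "grows m k g" shows "grows m (j + k) (\<lambda>y. prod (f y) (g y))"
proof -
  obtain C where C: "continuous_on UNIV f" "C \<ge> 0" "\<And>y. norm (f y) \<le> C * (1 + norm (y - m)) ^ j"
    using assms(1) by (auto simp: grows_def)
  obtain E where E: "continuous_on UNIV g" "E \<ge> 0" "\<And>y. norm (g y) \<le> E * (1 + norm (y - m)) ^ k"
    using assms(2) by (auto simp: grows_def)
  obtain K where K: "K > 0" "\<And>a b. norm (prod a b) \<le> norm a * norm b * K"
    using pos_bounded by blast
  have "norm (prod (f y) (g y)) \<le> (C * E * K) * (1 + norm (y - m)) ^ (j + k)" for y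
  proof -
    have "norm (prod (f y) (g y)) \<le> (C * (1 + norm (y - m)) ^ j) * (E * (1 + norm (y - m)) ^ k) * K"
      using C E K(1) by (intro order_trans[OF K(2)] mult_right_mono mult_mono) auto
    thus ?thesis by (simp add: power_add mult_ac)
  qed
  thus ?thesis using C E K(1)
    by (auto simp: grows_def intro!: continuous_on exI[of _ "C * E * K"])
qed

lemmas grows_mult = bounded_bilinear.grows_prod[OF bounded_bilinear_mult]
  and grows_inner = bounded_bilinear.grows_prod[OF bounded_bilinear_inner]

lemma grows_vec_nth:
  assumes "grows m k f" shows "grows m k (\<lambda>y. f y $ i)"
proof -
  have "norm (f y $ i) \<le> norm (f y)" for y by (simp add: Finite_Cartesian_Product.norm_nth_le)
  thus ?thesis using assms unfolding grows_def
    by (auto intro!: continuous_intros) (meson order_trans)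
qed

text \<open>One fixed parameter value: \<open>p\<close> is the model density there, and
  \<open>P ** P\<close> is its covariance matrix.\<close>

locale gaussian_model =
  fixes m :: "real^'d" and L :: "real^'d^'d"
  assumes L: "pos_def L"
begin

definition p :: "real^'d \<Rightarrow> real" where "p y = ell_model gauss_density y (m, L)"

definition P :: "real^'d^'d" where "P = matrix_inv L"

lemma P: "L ** P = mat 1" "P ** L = mat 1" "pos_def P"
  using pos_def_matrix_inv[OF L] by (simp_all add: P_def)

definition K :: real where "K = \<bar>det L\<bar> * (2 * pi) powr (- real CARD('d) / 2)"

lemma p_eq: "p y = K * exp (- (norm (L *v (y - m)))\<^sup>2 / 2)"
  by (simp add: p_def ell_model_def gauss_density_def K_def)

lemma det_L: "det L \<noteq> 0"
  using P by (metis invertible_def invertible_det_nz)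

lemma K_pos: "K > 0"
  using det_L by (simp add: K_def)

lemma p_pos: "p y > 0"
  using K_pos by (simp add: p_eq)

lemma L_inner: "(L *v u) \<bullet> (L *v v) = ((L ** L) *v u) \<bullet> v"
  using L by (simp add: pos_def_def sym_mat_inner_commute flip: matrix_vector_mul_assoc)

lemma p_has_derivative: "(p has_derivative (\<lambda>h. - p y * (((L ** L) *v (y - m)) \<bullet> h))) (at y)"
proof -
  have "((\<lambda>y. L *v (y - m)) has_derivative (\<lambda>h. L *v h)) (at y)"
    by (auto intro!: derivative_eq_intros bounded_linear.has_derivative[OF matrix_vector_mul_bounded_linear])
  hence "((\<lambda>y. K * exp (- (L *v (y - m)) \<bullet> (L *v (y - m)) / 2)) has_derivative
     (\<lambda>h. K * exp (- (L *v (y - m)) \<bullet> (L *v (y - m)) / 2) * - ((L *v (y - m)) \<bullet> (L *v h)))) (at y)"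
    by (auto intro!: derivative_eq_intros simp: inner_commute)
  thus ?thesis by (simp add: p_eq[abs_def] power2_norm_eq_inner L_inner)
qed

lemma continuous_on_p: "continuous_on S p"
  using p_has_derivative
  by (intro continuous_at_imp_continuous_on ballI) (blast intro: has_derivative_continuous)

lemma continuous_on_p_derivative: "continuous_on S (\<lambda>y. - p y * (((L ** L) *v (y - m)) \<bullet> h))"
  by (intro continuous_intros continuous_on_p linear_continuous_on_compose[where f = "\<lambda>y. y - m" and g = "(*v) (L ** L)"])
    auto

text \<open>Degree 4 accommodates the square of a quadratic score. Coercivity of
  \<open>L ** L\<close> bounds \<open>p\<close> by a multiple of \<open>exp (- c * s / 2)\<close>,
  with \<open>s\<close> the squared distance to \<open>m\<close>; half of this decay pays for the
  polynomial and the other half is integrable.\<close>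

lemma integrable_p_grows:
  assumes f: "grows m 4 f" shows "integrable lborel (\<lambda>y. p y * f y)"
proof -
  obtain C where C: "continuous_on UNIV f" "C \<ge> 0" "\<And>y. norm (f y) \<le> C * (1 + norm (y - m)) ^ 4"
    using f by (auto simp: grows_def)
  obtain c where c: "c > 0" "\<And>v. c * (norm v)\<^sup>2 \<le> v \<bullet> ((L ** L) *v v)"
    using pos_def_coercive[OF pos_def_square[OF L]] by blast
  define B where "B = K * C * 4 * (1 + 8 / c)\<^sup>2"
  have "integrable lborel (\<lambda>y::real^'d. B * exp (- (c / 4) * (norm (- m + y))\<^sup>2))"
    using c by (intro integrable_mult_right lborel_integrable_translate[OF integrable_exp_neg_norm_square]) auto
  thus ?thesis
  proof (rule Bochner_Integration.integrable_bound)
    show "(\<lambda>y. p y * f y) \<in> borel_measurable lborel"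
      by simp (intro borel_measurable_continuous_onI continuous_intros continuous_on_p C)
    show "AE y in lborel. norm (p y * f y) \<le> norm (B * exp (- (c / 4) * (norm (- m + y))\<^sup>2))"
    proof (intro always_eventually allI)
      fix y
      define s where "s = (norm (y - m))\<^sup>2"
      have s: "s \<ge> 0" by (simp add: s_def)
      have "c * s \<le> (norm (L *v (y - m)))\<^sup>2"
        using c(2)[of "y - m"] by (simp add: s_def power2_norm_eq_inner L_inner inner_commute)
      hence p: "p y \<le> K * exp (- c * s / 2)"
        using K_pos by (simp add: p_eq)
      have "(1 + norm (y - m))\<^sup>2 \<le> 2 * (1 + s)"
        using sum_squares_bound[of 1 "norm (y - m)"] by (simp add: s_def power2_eq_square algebra_simps)
      hence "((1 + norm (y - m))\<^sup>2)\<^sup>2 \<le> (2 * (1 + s))\<^sup>2" by (intro power_mono) auto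
      also have "\<dots> = 4 * (1 + s)\<^sup>2" by (simp only: power_mult_distrib) simp
      \<comment> \<open>The rate \<open>c / 8\<close> is chosen so that squaring costs
        \<open>exp (c * s / 4)\<close>, half of the available decay. The product of
        \<open>1 + 8 / c\<close> with \<open>1 + c * s / 8\<close> contains both \<open>1\<close>
        and \<open>s\<close>.\<close>
      also have "(1 + s)\<^sup>2 \<le> ((1 + 8 / c) * exp (c * s / 8))\<^sup>2"
      proof (rule power_mono)
        have "1 + s \<le> (1 + 8 / c) * (1 + c * s / 8)"
          using c s by (simp add: field_simps)
        also have "\<dots> \<le> (1 + 8 / c) * exp (c * s / 8)"
          using c by (intro mult_left_mono exp_ge_add_one_self) auto
        finally show "1 + s \<le> (1 + 8 / c) * exp (c * s / 8)" .
      qed (use s in auto)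
      finally have q: "(1 + norm (y - m)) ^ 4 \<le> 4 * (1 + 8 / c)\<^sup>2 * exp (c * s / 4)"
        by (simp add: power_mult_distrib exp_double[symmetric])
      have "norm (p y * f y) \<le> (K * exp (- c * s / 2)) * (C * (4 * (1 + 8 / c)\<^sup>2 * exp (c * s / 4)))"
        unfolding norm_mult using p p_pos[of y] C K_pos
        by (intro mult_mono order_trans[OF C(3)] mult_left_mono q) auto
      also have "\<dots> = B * (exp (- c * s / 2) * exp (c * s / 4))"
        by (simp add: B_def)
      also have "exp (- c * s / 2) * exp (c * s / 4) = exp (- (c / 4) * s)"
        by (simp flip: exp_add)
      finally show "norm (p y * f y) \<le> norm (B * exp (- (c / 4) * (norm (- m + y))\<^sup>2))"
        by (simp add: s_def)
    qed
  qed
qed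

end

text \<open>Turns a Lyapunov equation into an identity between quadratic forms, the shape in which
  it enters the score equation.\<close>

lemma inner_anticommutator:
  fixes A H :: "real^'d^'d"
  assumes A: "sym_mat A" and H: "sym_mat H"
  shows "z \<bullet> ((A ** H + H ** A) *v z) = 2 * ((A *v z) \<bullet> (H *v z))"
proof -
  have "z \<bullet> ((A ** H) *v z) = (A *v z) \<bullet> (H *v z)"
    unfolding sym_mat_inner_commute[OF A] by (simp add: matrix_vector_mul_assoc)
  moreover have "z \<bullet> ((H ** A) *v z) = (H *v z) \<bullet> (A *v z)"
    unfolding sym_mat_inner_commute[OF H] by (simp add: matrix_vector_mul_assoc)
  ultimately show ?thesis
    by (simp add: matrix_vector_mult_add_rdistrib inner_add_right inner_commute)
qed

context gaussian_model
begin

section \<open>The density times an affine field\<close>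

lemma affine_has_derivative: "((\<lambda>z. u + H *v (z - m)) has_derivative (*v) (H :: real^'d^'d)) (at y)"
  by (auto intro!: derivative_eq_intros bounded_linear.has_derivative[OF matrix_vector_mul_bounded_linear])

lemma grows_affine: "grows m 1 (\<lambda>y. u + H *v (y - m :: real^'d))"
  by (intro grows_add grows_const grows_linear matrix_vector_mul_bounded_linear)

lemma sum_matrix_axis: "(\<Sum>i\<in>UNIV. ((H::real^'d^'d) *v axis i 1) $ i) = mat 1 \<bullet> H"
  by (simp add: matrix_vector_mult_basis column_def trace_def flip: trace_eq_inner)

lemma p_affine_has_derivative:
  "((\<lambda>z. p z *\<^sub>R (u + (H :: real^'d^'d) *v (z - m))) has_derivative
     (\<lambda>h. p y *\<^sub>R (H *v h - (((L ** L) *v (y - m)) \<bullet> h) *\<^sub>R (u + H *v (y - m))))) (at y)"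
  by (rule has_derivative_eq_rhs[OF has_derivative_scaleR_field[OF p_has_derivative affine_has_derivative]])
    (simp add: algebra_simps)

text \<open>The trace \<open>mat 1 \<bullet> H\<close> is the divergence of the affine field itself,
  and the other term comes from the gradient of \<open>p\<close>. With the gradient of a quadratic
  score as the field, this is the left side of the score equation.\<close>

lemma divergence_p_affine:
  "divergence (\<lambda>z. p z *\<^sub>R (u + H *v (z - m))) y
    = p y * (mat 1 \<bullet> H - ((L ** L) *v (y - m)) \<bullet> (u + H *v (y - m)))"
  by (simp add: divergence_eq[OF p_affine_has_derivative] inner_axis_1 inner_vec_def[of _ "_ + _"]
      sum_subtractf right_diff_distrib sum_matrix_axis flip: sum_distrib_left)

text \<open>The divergence theorem without boundary term, one coordinate at a time. It stands in for
  explicit first and second Gaussian moments.\<close>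

lemma integral_divergence_p_affine:
  "(\<integral>y. p y * (mat 1 \<bullet> H - ((L ** L) *v (y - m)) \<bullet> (u + H *v (y - m))) \<partial>lborel) = 0"
proof -
  define \<phi> where "\<phi> i y = p y * (u + H *v (y - m)) $ i" for i y
  define q where "q i h y = (H *v h) $ i - (((L ** L) *v (y - m)) \<bullet> h) * (u + H *v (y - m)) $ i" for i h y
  have \<phi>: "(\<phi> i has_derivative (\<lambda>h. p y * q i h y)) (at y)" for i y
    using bounded_linear.has_derivative[OF bounded_linear_vec_nth[of i] p_affine_has_derivative[of u H y]]
    by (simp add: \<phi>_def[abs_def] q_def)
  have q: "grows m 2 (q i h)" for i h
  proof -
    have "grows m (1 + 1) (\<lambda>y. (- (((L ** L) *v (y - m)) \<bullet> h)) * (u + H *v (y - m)) $ i)"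
      by (intro grows_mult grows_vec_nth grows_affine
          grows_linear[where f = "\<lambda>z. - (((L ** L) *v z) \<bullet> h)"] bounded_linear_minus
          bounded_linear_compose[OF bounded_linear_inner_left] matrix_vector_mul_bounded_linear)
    from grows_add[OF grows_const[of m "1 + 1" "(H *v h) $ i"] this] show ?thesis
      by (simp add: q_def[abs_def] numeral_2_eq_2)
  qed
  have iq: "integrable lborel (\<lambda>y. p y * q i h y)" for i h
    by (intro integrable_p_grows grows_mono[OF q]) simp
  have "(\<integral>y. p y * q i (axis i 1) y \<partial>lborel) = 0" for i
  proof (rule integral_directional_derivative_eq_0[OF \<phi> _ _ iq])
    show "continuous_on UNIV (\<lambda>y. p y * q i (axis i 1) y)"
      using q by (intro continuous_intros continuous_on_p) (simp add: grows_def)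
    show "integrable lborel (\<phi> i)"
      unfolding \<phi>_def[abs_def] by (intro integrable_p_grows grows_mono[OF grows_vec_nth[OF grows_affine]]) simp
  qed
  hence "(\<integral>y. (\<Sum>i\<in>UNIV. p y * q i (axis i 1) y) \<partial>lborel) = 0"
    by (subst Bochner_Integration.integral_sum) (auto intro: iq)
  moreover have "(\<Sum>i\<in>UNIV. p y * q i (axis i 1) y)
      = p y * (mat 1 \<bullet> H - ((L ** L) *v (y - m)) \<bullet> (u + H *v (y - m)))" for y
    by (simp add: q_def inner_axis_1 inner_vec_def[of _ "_ + _"] sum_subtractf sum_matrix_axis
        flip: sum_distrib_left)
  ultimately show ?thesis by simp
qed

text \<open>Lets \<open>w_score_unique\<close> conclude that a constant of mean zero is
  zero.\<close>

lemma integral_p_pos: "0 < (\<integral>y. p y \<partial>lborel)"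
proof -
  have "integrable lborel (\<lambda>y. p y * 1)" by (intro integrable_p_grows grows_const)
  hence i: "integrable lborel p" by simp
  have "(\<integral>y. p y \<partial>lborel) \<noteq> 0"
    using continuous_nonneg_integral_0_imp_0[OF continuous_on_p _ i] p_pos
    by (metis less_eq_real_def less_irrefl)
  moreover have "0 \<le> (\<integral>y. p y \<partial>lborel)"
    using p_pos by (intro Bochner_Integration.integral_nonneg) (simp add: less_imp_le)
  ultimately show ?thesis by simp
qed

section \<open>The log-likelihood score\<close>

definition loglik_score :: "real^'d \<Rightarrow> real^'d \<Rightarrow> real^'d^'d \<Rightarrow> real" where
  "loglik_score x u V = P \<bullet> V - (L *v (x - m)) \<bullet> (V *v (x - m) - L *v u)"

text \<open>Along the parameter line the argument of the Gaussian is a quadratic polynomial in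
  \<open>t\<close>, whose second-order coefficient \<open>e\<close> drops out at
  \<open>t = 0\<close>. Factoring \<open>L\<close> out of the determinant reduces its derivative to
  the one at the identity, where the absolute value is harmless.\<close>

lemma DERIV_ell_model:
  "DERIV (\<lambda>t. ell_model gauss_density x ((m, L) + t *\<^sub>R (u, V))) 0 :> p x * loglik_score x u V"
proof -
  define a b e where "a = L *v (x - m)" and "b = V *v (x - m) - L *v u" and "e = V *v u"
  have quad: "(L + t *\<^sub>R V) *v (x - (m + t *\<^sub>R u)) = a + t *\<^sub>R b - (t * t) *\<^sub>R e" for t
    by (simp add: a_def b_def e_def algebra_simps scaleR_matrix_vector_assoc[symmetric])
  have detL: "det (L + t *\<^sub>R V) = det L * det (mat 1 + t *\<^sub>R (P ** V))" for t
  proof -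
    have "L + t *\<^sub>R V = L ** (mat 1 + t *\<^sub>R (P ** V))"
      by (simp add: matrix_add_ldistrib matrix_scaleR_right matrix_mul_assoc P)
    thus ?thesis by (simp add: det_mul)
  qed
  have "trace (P ** V) = P \<bullet> V"
    by (simp add: trace_eq_inner inner_matrix_mult_right pos_def_transpose[OF P(3)])
  hence det': "DERIV (\<lambda>t. \<bar>det (mat 1 + t *\<^sub>R (P ** V))\<bar>) 0 :> P \<bullet> V"
    using DERIV_abs_pos[OF DERIV_det_at_mat_1[of "P ** V"]] by simp
  have exp': "DERIV (\<lambda>t. exp (- ((a + t *\<^sub>R b - (t * t) *\<^sub>R e) \<bullet> (a + t *\<^sub>R b - (t * t) *\<^sub>R e)) / 2)) 0
      :> exp (- (a \<bullet> a) / 2) * - (a \<bullet> b)"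
    unfolding inner_diff inner_add inner_scaleR_left inner_scaleR_right
    by (auto intro!: derivative_eq_intros simp: inner_commute)
  have "DERIV (\<lambda>t. K * (\<bar>det (mat 1 + t *\<^sub>R (P ** V))\<bar> *
      exp (- ((a + t *\<^sub>R b - (t * t) *\<^sub>R e) \<bullet> (a + t *\<^sub>R b - (t * t) *\<^sub>R e)) / 2))) 0
      :> K * (P \<bullet> V * exp (- (a \<bullet> a) / 2) + exp (- (a \<bullet> a) / 2) * - (a \<bullet> b) * 1)"
    using DERIV_cmult[OF DERIV_mult[OF det' exp'], of K] by simp
  moreover have "K * (P \<bullet> V * exp (- (a \<bullet> a) / 2) + exp (- (a \<bullet> a) / 2) * - (a \<bullet> b) * 1) = p x * loglik_score x u V"
    by (simp add: p_eq loglik_score_def power2_norm_eq_inner a_def b_def algebra_simps)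
  moreover have "ell_model gauss_density x ((m, L) + t *\<^sub>R (u, V)) = K * (\<bar>det (mat 1 + t *\<^sub>R (P ** V))\<bar> *
      exp (- ((a + t *\<^sub>R b - (t * t) *\<^sub>R e) \<bullet> (a + t *\<^sub>R b - (t * t) *\<^sub>R e)) / 2))" for t
    by (simp add: ell_model_def gauss_density_def detL quad K_def abs_mult power2_norm_eq_inner)
  ultimately show ?thesis by simp
qed

lemma param_deriv_ell_model:
  "param_deriv (ell_model gauss_density) x (m, L) (u, V) = p x * loglik_score x u V"
  unfolding param_deriv_def by (rule DERIV_imp_deriv[OF DERIV_ell_model])

lemma param_deriv_ln_ell_model:
  "param_deriv (\<lambda>y \<theta>. ln (ell_model gauss_density y \<theta>)) x (m, L) (u, V) = loglik_score x u V"
proof -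
  have p0: "ell_model gauss_density x ((m, L) + 0 *\<^sub>R (u, V)) = p x" by (simp add: p_def)
  have "DERIV (\<lambda>t. ln (ell_model gauss_density x ((m, L) + t *\<^sub>R (u, V)))) 0 :> 1 / p x * (p x * loglik_score x u V)"
    by (rule DERIV_chain2[OF _ DERIV_ell_model]) (use DERIV_ln_divide[OF p_pos] p0 in simp)
  thus ?thesis unfolding param_deriv_def using p_pos[of x] by (simp add: DERIV_imp_deriv)
qed

section \<open>The Wasserstein score: explicit solution and uniqueness\<close>

definition gauss_w_score :: "real^'d \<Rightarrow> real^'d^'d \<Rightarrow> real^'d \<Rightarrow> real" where
  "gauss_w_score u H y = u \<bullet> (y - m) + (y - m) \<bullet> (H *v (y - m)) / 2 - H \<bullet> (P ** P) / 2"

text \<open>With an affine gradient the score equation, divided by \<open>p\<close>, is a polynomial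
  identity of degree two in \<open>y - m\<close>. The linear parts agree by the choice of
  \<open>u\<close>; the Lyapunov equation gives the quadratic part when evaluated as a form, and the
  constant part when paired with \<open>P ** P\<close>.\<close>

lemma w_score_gauss_w_score:
  assumes H: "sym_mat H" and V: "sym_mat V"
    and eq: "(L ** L) ** H + H ** (L ** L) = - (L ** V + V ** L)"
  shows "w_score (ell_model gauss_density) (m, L) (u, V) (gauss_w_score u H)"
proof -
  let ?A = "L ** L" and ?S = "gauss_w_score u H" and ?G = "\<lambda>y. u + H *v (y - m)"
  have quad: "(?A *v z) \<bullet> (H *v z) = - ((L *v z) \<bullet> (V *v z))" for z
  proof -
    have "z \<bullet> ((?A ** H + H ** ?A) *v z) = 2 * ((?A *v z) \<bullet> (H *v z))"
      using H pos_def_square[OF L] by (simp add: inner_anticommutator pos_def_def)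
    moreover have "z \<bullet> ((L ** V + V ** L) *v z) = 2 * ((L *v z) \<bullet> (V *v z))"
      using V L by (simp add: inner_anticommutator pos_def_def)
    moreover have "(- (L ** V + V ** L)) *v z = - ((L ** V + V ** L) *v z)"
      by (metis diff_0 matrix_vector_mult_0 matrix_vector_mult_diff_rdistrib)
    ultimately show ?thesis using eq by simp
  qed
  have PA: "(P ** P) ** ?A = mat 1"
    by (metis P(2) matrix_mul_assoc matrix_mul_rid)
  have tr: "mat 1 \<bullet> H = - (P \<bullet> V)"
  proof -
    have tP: "transpose P = P" and tPP: "transpose (P ** P) = P ** P"
      using P(3) by (simp_all add: pos_def_transpose matrix_transpose_mul)
    have AP: "?A ** (P ** P) = mat 1" by (metis P(1) matrix_mul_assoc matrix_mul_rid)
    have tA: "transpose ?A = ?A" "transpose L = L"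
      using L pos_def_square[OF L] by (simp_all add: pos_def_transpose)
    \<comment> \<open>Each factor \<open>?A\<close> moves to the other side of the inner product,
      where it cancels \<open>P ** P\<close>.\<close>
    have "(P ** P) \<bullet> (?A ** H + H ** ?A) = 2 * (mat 1 \<bullet> H)"
      by (simp add: inner_add_right inner_matrix_mult_right[of _ ?A H] inner_matrix_mult_left[of _ H ?A] tA AP PA)
    moreover have "L ** (P ** P) = P" "(P ** P) ** L = P"
      by (metis P(1) matrix_mul_assoc matrix_mul_lid, metis P(2) matrix_mul_assoc matrix_mul_rid)
    hence "(P ** P) \<bullet> (L ** V + V ** L) = 2 * (P \<bullet> V)"
      by (simp add: inner_add_right inner_matrix_mult_right[of _ L V] inner_matrix_mult_left[of _ V L] tA)
    ultimately show ?thesis using eq by (simp add: inner_diff_right inner_add_right)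
  qed
  have S: "(?S has_derivative (\<lambda>h. ?G y \<bullet> h)) (at y)" for y
  proof -
    have "((\<lambda>z. H *v (z - m)) has_derivative (*v) H) (at y)"
      using affine_has_derivative[of 0 H y] by simp
    thus ?thesis unfolding gauss_w_score_def[abs_def]
      by (auto intro!: derivative_eq_intros simp: inner_add sym_mat_inner_commute[OF H] inner_commute)
  qed
  have div: "divergence (\<lambda>z. p z *\<^sub>R ?G z) y = - (p y * loglik_score y u V)" for y
  proof -
    have "(?A *v (y - m)) \<bullet> u = (L *v (y - m)) \<bullet> (L *v u)" by (simp add: L_inner)
    hence "mat 1 \<bullet> H - (?A *v (y - m)) \<bullet> (u + H *v (y - m)) = - loglik_score y u V"
      by (simp add: inner_add_right inner_diff_right tr quad loglik_score_def)
    thus ?thesis unfolding divergence_p_affine by simp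
  qed
  have growsS: "grows m 2 ?S"
  proof -
    have 1: "grows m 1 (\<lambda>y. u \<bullet> (y - m))"
      by (rule grows_linear[OF bounded_linear_inner_right])
    have "grows m (1 + 1) (\<lambda>y. ((1 / 2) *\<^sub>R (y - m)) \<bullet> (H *v (y - m)))"
      by (intro grows_inner grows_linear[where f = "\<lambda>z. (1 / 2) *\<^sub>R z"] grows_linear[where f = "(*v) H"]
          bounded_linear_scaleR_right matrix_vector_mul_bounded_linear)
    hence 2: "grows m 2 (\<lambda>y. ((1 / 2) *\<^sub>R (y - m)) \<bullet> (H *v (y - m)))" by (simp add: numeral_2_eq_2)
    from grows_add[OF grows_add[OF grows_mono[OF 1, of 2] 2] grows_const[of m 2 "- (H \<bullet> (P ** P) / 2)"]]
    show ?thesis by (simp add: gauss_w_score_def[abs_def])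
  qed
  have iS: "integrable lborel (\<lambda>y. p y * ?S y)"
    by (intro integrable_p_grows grows_mono[OF growsS]) simp
  have iS2: "integrable lborel (\<lambda>y. p y * (?S y)\<^sup>2)"
    using integrable_p_grows[OF grows_mono[OF grows_mult[OF growsS growsS], of 4]]
    by (simp add: power2_eq_square)
  have iG: "integrable lborel (\<lambda>y. p y * (norm (?G y))\<^sup>2)"
    using integrable_p_grows[OF grows_mono[OF grows_inner[OF grows_affine grows_affine], of 4]]
    by (simp add: power2_norm_eq_inner)
  have ES: "(\<integral>y. p y * ?S y \<partial>lborel) = 0"
  proof -
    let ?B = "P ** P"
    have tA: "transpose ?A = ?A" using pos_def_square[OF L] by (simp add: pos_def_transpose)
    have AB: "?A ** ?B = mat 1" by (metis P(1) matrix_mul_assoc matrix_mul_rid)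
    have tB: "transpose ?B = ?B" using P(3) by (simp add: pos_def_transpose matrix_transpose_mul)
    \<comment> \<open>The affine field is chosen so that the divergence of \<open>p\<close> times it
      is \<open>- p\<close> times the score, constant term included; the mean then vanishes by
      \<open>integral_divergence_p_affine\<close>.\<close>
    have "mat 1 \<bullet> ((1/2) *\<^sub>R (?B ** H)) - (?A *v (y - m)) \<bullet> (?B *v u + ((1/2) *\<^sub>R (?B ** H)) *v (y - m))
       = - ?S y" for y
    proof -
      have "(?A *v (y - m)) \<bullet> (?B *v w) = (y - m) \<bullet> w" for w
        using pos_def_square[OF L] AB
        by (simp add: pos_def_def sym_mat_inner_commute matrix_vector_mul_assoc)
      moreover have "mat 1 \<bullet> (?B ** H) = H \<bullet> ?B"
        by (simp add: inner_matrix_mult_right[of _ ?B H] tB inner_commute[of H])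
      ultimately show ?thesis
        by (simp add: gauss_w_score_def inner_add_right scaleR_matrix_vector_assoc[symmetric]
            inner_commute[of u] flip: matrix_vector_mul_assoc[of ?B H])
    qed
    with integral_divergence_p_affine[of "(1/2) *\<^sub>R (?B ** H)" "?B *v u"] show ?thesis by simp
  qed
  have G': "(?G has_derivative blinfun_apply (Blinfun ((*v) H))) (at y)" for y
    using affine_has_derivative[of u H y] by (simp add: bounded_linear_Blinfun_apply)
  show ?thesis
    unfolding w_score_def param_deriv_ell_model p_def[symmetric]
    by (intro exI[of _ ?G] exI[of _ "\<lambda>_. Blinfun ((*v) H)"] conjI allI S G' iS ES iS2 iG div continuous_on_const)
qed

text \<open>For the difference of two scores the right-hand sides cancel, so
  \<open>divergence_free_gradient_eq_0\<close> makes it constant, and zero mean makes the constant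
  zero.\<close>

lemma w_score_unique:
  assumes "w_score (ell_model gauss_density) (m, L) v S1" "w_score (ell_model gauss_density) (m, L) v S2"
  shows "S1 = S2"
proof -
  have ex: "\<exists>G G'. (\<forall>y. (S has_derivative (\<lambda>h. G y \<bullet> h)) (at y))
          \<and> (\<forall>y. (G has_derivative blinfun_apply (G' y)) (at y))
          \<and> continuous_on UNIV G'
          \<and> (\<forall>y. divergence (\<lambda>z. p z *\<^sub>R G z) y = - param_deriv (ell_model gauss_density) y (m, L) v)
          \<and> integrable lborel (\<lambda>y. p y * S y)
          \<and> (\<integral>y. p y * S y \<partial>lborel) = 0
          \<and> integrable lborel (\<lambda>y. p y * (S y)\<^sup>2)
          \<and> integrable lborel (\<lambda>y. p y * (norm (G y))\<^sup>2)"
    if "w_score (ell_model gauss_density) (m, L) v S" for S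
    using that unfolding w_score_def p_def[symmetric] .
  from ex[OF assms(1)] obtain G1 G1' where 1: "\<And>y. (S1 has_derivative (\<lambda>h. G1 y \<bullet> h)) (at y)"
      "\<And>y. (G1 has_derivative blinfun_apply (G1' y)) (at y)" "continuous_on UNIV G1'"
      "\<And>y. divergence (\<lambda>z. p z *\<^sub>R G1 z) y = - param_deriv (ell_model gauss_density) y (m, L) v"
      "integrable lborel (\<lambda>y. p y * S1 y)" "(\<integral>y. p y * S1 y \<partial>lborel) = 0"
      "integrable lborel (\<lambda>y. p y * (S1 y)\<^sup>2)" "integrable lborel (\<lambda>y. p y * (norm (G1 y))\<^sup>2)"
    by blast
  from ex[OF assms(2)] obtain G2 G2' where 2: "\<And>y. (S2 has_derivative (\<lambda>h. G2 y \<bullet> h)) (at y)"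
      "\<And>y. (G2 has_derivative blinfun_apply (G2' y)) (at y)" "continuous_on UNIV G2'"
      "\<And>y. divergence (\<lambda>z. p z *\<^sub>R G2 z) y = - param_deriv (ell_model gauss_density) y (m, L) v"
      "integrable lborel (\<lambda>y. p y * S2 y)" "(\<integral>y. p y * S2 y \<partial>lborel) = 0"
      "integrable lborel (\<lambda>y. p y * (S2 y)\<^sup>2)" "integrable lborel (\<lambda>y. p y * (norm (G2 y))\<^sup>2)"
    by blast
  define D where "D y = S1 y - S2 y" for y
  define G where "G y = G1 y - G2 y" for y
  have D: "(D has_derivative (\<lambda>h. G y \<bullet> h)) (at y)" for y
    using has_derivative_diff[OF 1(1)[of y] 2(1)[of y]] by (simp add: D_def[abs_def] G_def inner_diff_left)
  have G: "(G has_derivative blinfun_apply (G1' y - G2' y)) (at y)" for y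
    using has_derivative_diff[OF 1(2)[of y] 2(2)[of y]]
    by (simp add: G_def[abs_def] minus_blinfun.rep_eq)
  have cont: "continuous_on UNIV D" "continuous_on UNIV G"
    using D G by (auto intro!: continuous_at_imp_continuous_on has_derivative_continuous)
  \<comment> \<open>From the parallelogram law: differences of square-integrable functions stay
    square integrable. Stated for any inner product space, so that it serves the scores and their
    gradients.\<close>
  have bound: "norm (p y * (norm (a - b))\<^sup>2) \<le> norm (2 * (p y * (norm a)\<^sup>2) + 2 * (p y * (norm b)\<^sup>2))"
    for y and a b :: "'v::real_inner"
  proof -
    have "(norm (a - b))\<^sup>2 + (norm (a + b))\<^sup>2 = 2 * (norm a)\<^sup>2 + 2 * (norm b)\<^sup>2"
      by (simp add: power2_norm_eq_inner inner_diff inner_add inner_commute)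
    hence "(norm (a - b))\<^sup>2 \<le> 2 * (norm a)\<^sup>2 + 2 * (norm b)\<^sup>2"
      using zero_le_power2[of "norm (a + b)"] by linarith
    hence "p y * (norm (a - b))\<^sup>2 \<le> p y * (2 * (norm a)\<^sup>2 + 2 * (norm b)\<^sup>2)"
      using p_pos[of y] by (intro mult_left_mono) auto
    thus ?thesis using p_pos[of y] by (simp add: algebra_simps)
  qed
  have "G y = 0" for y
  proof (rule divergence_free_gradient_eq_0[OF p_has_derivative continuous_on_p_derivative p_pos D G])
    show "continuous_on UNIV (\<lambda>y. blinfun_apply (G1' y - G2' y) h)" for h
      by (intro continuous_intros 1 2)
    show "divergence (\<lambda>z. p z *\<^sub>R G z) y = 0" for y
      using divergence_scaleR_diff[OF p_has_derivative 1(2) 2(2), of y] 1(4) 2(4) by (simp add: G_def)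
    show "integrable lborel (\<lambda>y. p y * (D y)\<^sup>2)"
    proof (rule Bochner_Integration.integrable_bound)
      show "integrable lborel (\<lambda>y. 2 * (p y * (S1 y)\<^sup>2) + 2 * (p y * (S2 y)\<^sup>2))"
        using 1(7) 2(7) by simp
      show "(\<lambda>y. p y * (D y)\<^sup>2) \<in> borel_measurable lborel"
        by simp (intro borel_measurable_continuous_onI continuous_intros continuous_on_p cont)
      show "AE y in lborel. norm (p y * (D y)\<^sup>2) \<le> norm (2 * (p y * (S1 y)\<^sup>2) + 2 * (p y * (S2 y)\<^sup>2))"
        using bound[of _ "S1 _" "S2 _"] by (simp add: D_def)
    qed
    show "integrable lborel (\<lambda>y. p y * (norm (G y))\<^sup>2)"
    proof (rule Bochner_Integration.integrable_bound)
      show "integrable lborel (\<lambda>y. 2 * (p y * (norm (G1 y))\<^sup>2) + 2 * (p y * (norm (G2 y))\<^sup>2))"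
        using 1(8) 2(8) by simp
      show "(\<lambda>y. p y * (norm (G y))\<^sup>2) \<in> borel_measurable lborel"
        by simp (intro borel_measurable_continuous_onI continuous_intros continuous_on_p cont)
      show "AE y in lborel. norm (p y * (norm (G y))\<^sup>2) \<le> norm (2 * (p y * (norm (G1 y))\<^sup>2) + 2 * (p y * (norm (G2 y))\<^sup>2))"
        unfolding G_def by (intro always_eventually allI bound)
    qed
  qed
  hence "(D has_derivative (\<lambda>h. 0)) (at y)" for y using D[of y] by simp
  hence const: "D y = D 0" for y by (rule derivative_zero_imp_constant)
  have "(\<integral>y. p y * D y \<partial>lborel) = 0"
    using 1(5,6) 2(5,6) by (simp add: D_def right_diff_distrib)
  moreover have "(\<lambda>y. p y * D y) = (\<lambda>y. p y * D 0)"
    by (rule ext, rule arg_cong2[OF refl const])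
  ultimately have "(\<integral>y. p y \<partial>lborel) * D 0 = 0" by simp
  hence "D 0 = 0" using integral_p_pos by simp
  hence "D y = 0" for y using const[of y] by simp
  thus ?thesis by (simp add: D_def fun_eq_iff)
qed

end

section \<open>The estimating equations\<close>

definition outer :: "real^'d \<Rightarrow> real^'d^'d" where
  "outer v = (\<chi> i j. v $ i * v $ j)"

definition moment :: "nat \<Rightarrow> (nat \<Rightarrow> real^'d) \<Rightarrow> real^'d \<Rightarrow> real^'d^'d" where
  "moment n x m = (1 / real n) *\<^sub>R (\<Sum>t=1..n. outer (x t - m))"

lemma inner_eq_outer: "v \<bullet> (A *v v) = outer v \<bullet> A"
  by (simp add: inner_matrix_vector outer_def)

lemma sample_cov_eq_moment: "sample_cov n x = moment n x (sample_mean n x)"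
  by (simp add: sample_cov_def moment_def outer_def)

lemma sym_mat_moment: "sym_mat (moment n x m)"
  by (simp add: sym_mat_def moment_def outer_def transpose_def vec_eq_iff mult.commute)

lemma average_inner_moment:
  "(1 / real n) * (\<Sum>t=1..n. outer (x t - m) \<bullet> A) = moment n x m \<bullet> A"
  by (simp add: moment_def inner_sum_left)

lemma average_inner_mean:
  assumes "n > 0"
  shows "(1 / real n) * (\<Sum>t=1..n. u \<bullet> (x t - m)) = u \<bullet> (sample_mean n x - m)"
proof -
  have "(\<Sum>t=1..n. x t - m) = real n *\<^sub>R (sample_mean n x - m)"
    using assms by (simp add: sum_subtractf sample_mean_def algebra_simps sum_constant_scaleR del: sum_constant)
  thus ?thesis using assms by (simp flip: inner_sum_right)
qed

lemma ball_param_dirs: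
  "(\<forall>v\<in>param_dirs. Q v) \<longleftrightarrow> (\<forall>i. Q (axis i 1, 0)) \<and> (\<forall>i j. Q (0, sym_unit i j))"
  by (auto simp: param_dirs_def)

lemma sym_mat_sym_unit: "sym_mat (sym_unit i j)"
  by (auto simp: sym_mat_def sym_unit_def transpose_def vec_eq_iff)

lemma sym_mat_anticommutator:
  assumes "sym_mat A" "sym_mat B" shows "sym_mat (A ** B + B ** A)"
  using assms by (simp add: sym_mat_def transpose_add matrix_transpose_mul add.commute)

text \<open>Anticommutation with a symmetric matrix is self-adjoint; in \<open>wass_set_iff\<close>
  this moves the Lyapunov operator from the sample side onto \<open>H\<close>.\<close>

lemma inner_anticommutator_right:
  fixes V L X :: "real^'d^'d"
  assumes "sym_mat L"
  shows "V \<bullet> (L ** X + X ** L) = (L ** V + V ** L) \<bullet> X"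
  using assms by (simp add: inner_add_right inner_add_left inner_matrix_mult_right[of V L X]
      inner_matrix_mult_left[of V X L] sym_mat_def)

context gaussian_model
begin

lemma sym: "sym_mat L" "sym_mat P" "sym_mat (P ** P)"
  using L P(3) pos_def_square[OF P(3)] by (simp_all add: pos_def_def)

text \<open>The score is a quadratic polynomial in \<open>x t - m\<close>, so the sample enters only
  through its mean and its second moment about \<open>m\<close>.\<close>

lemma average_loglik_score:
  assumes "n > 0"
  shows "(1 / real n) * (\<Sum>t=1..n. loglik_score (x t) u V)
    = V \<bullet> (P - L ** moment n x m) + ((L ** L) *v u) \<bullet> (sample_mean n x - m)"
proof -
  have score: "loglik_score y u V = P \<bullet> V - outer (y - m) \<bullet> (L ** V) + ((L ** L) *v u) \<bullet> (y - m)" for y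
    using sym_mat_inner_commute[OF sym(1), of "y - m" "V *v (y - m)"] L_inner[of u "y - m"]
    by (simp add: loglik_score_def inner_diff_right inner_commute[of "L *v (y - m)" "L *v u"]
        matrix_vector_mul_assoc flip: inner_eq_outer)
  have "(1 / real n) * (\<Sum>t=1..n. loglik_score (x t) u V) = P \<bullet> V
      - (1 / real n) * (\<Sum>t=1..n. outer (x t - m) \<bullet> (L ** V))
      + (1 / real n) * (\<Sum>t=1..n. ((L ** L) *v u) \<bullet> (x t - m))"
    unfolding score sum.distrib sum_subtractf using assms
    by (simp add: add_divide_distrib diff_divide_distrib)
  also have "\<dots> = P \<bullet> V - moment n x m \<bullet> (L ** V) + ((L ** L) *v u) \<bullet> (sample_mean n x - m)"
    by (simp only: average_inner_moment average_inner_mean[OF assms])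
  also have "moment n x m \<bullet> (L ** V) = V \<bullet> (L ** moment n x m)"
    using sym(1) by (simp add: inner_matrix_mult_right[of _ L V] sym_mat_def inner_commute[of V])
  finally show ?thesis by (simp add: inner_diff_right inner_commute)
qed

lemma average_gauss_w_score:
  assumes "n > 0"
  shows "(1 / real n) * (\<Sum>t=1..n. gauss_w_score u H (x t))
    = u \<bullet> (sample_mean n x - m) + H \<bullet> (moment n x m - P ** P) / 2"
proof -
  have "(1 / real n) * (\<Sum>t=1..n. gauss_w_score u H (x t)) = 
      (1 / real n) * (\<Sum>t=1..n. u \<bullet> (x t - m))
      + ((1 / real n) * (\<Sum>t=1..n. outer (x t - m) \<bullet> H)) / 2 - H \<bullet> (P ** P) / 2"
    unfolding gauss_w_score_def inner_eq_outer sum.distrib sum_subtractf sum_divide_distrib[symmetric]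
    using assms by (simp add: add_divide_distrib diff_divide_distrib mult.commute)
  also have "\<dots> = u \<bullet> (sample_mean n x - m) + (moment n x m \<bullet> H) / 2 - H \<bullet> (P ** P) / 2"
    by (simp only: average_inner_moment average_inner_mean[OF assms])
  finally show ?thesis by (simp add: inner_diff_right inner_commute diff_divide_distrib)
qed

lemma mean_eq_of_axis:
  assumes "\<And>i. axis i 1 \<bullet> (z - m) = 0" shows "m = z"
  using assms by (simp add: vec_eq_iff inner_commute[of "axis _ _"] inner_axis_1)

lemma mle_set_iff:
  assumes n: "n > 0"
  shows "(m, L) \<in> mle_set (ell_model gauss_density) n x
    \<longleftrightarrow> m = sample_mean n x \<and> sample_cov n x = P ** P"
proof
  assume "(m, L) \<in> mle_set (ell_model gauss_density) n x"
  hence "\<forall>v\<in>param_dirs. (1 / real n) *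
      (\<Sum>t=1..n. param_deriv (\<lambda>y \<theta>. ln (ell_model gauss_density y \<theta>)) (x t) (m, L) v) = 0"
    unfolding mle_set_def by blast
  note eqs = this[unfolded ball_param_dirs param_deriv_ln_ell_model average_loglik_score[OF n]]
  have eq: "axis i 1 \<bullet> ((L ** L) *v (sample_mean n x - m)) = 0"
      "sym_unit i j \<bullet> (P - L ** moment n x m) = 0" for i j
    using eqs sym_mat_inner_commute[of "L ** L"] pos_def_square[OF L]
    by (simp_all add: pos_def_def)
  from eq(1) have "(L ** L) *v (sample_mean n x - m) = 0"
    by (simp add: vec_eq_iff inner_commute[of "axis _ _"] inner_axis_1)
  hence m: "m = sample_mean n x"
    using pos_def_square[OF L] unfolding pos_def_def by (metis inner_zero_right less_irrefl right_minus_eq)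
  define X where "X = sample_cov n x - P ** P"
  have X: "sym_mat X" using sym sym_mat_moment[of n x]
    by (simp add: X_def sample_cov_eq_moment sym_mat_def transpose_diff)
  have LX: "L ** X = - (P - L ** moment n x m)"
    by (simp add: X_def matrix_sub_ldistrib sample_cov_eq_moment m matrix_mul_assoc P)
  have "sym_unit i j \<bullet> (L ** X + X ** L) = 0" for i j
  proof -
    \<comment> \<open>A symmetric direction cannot distinguish \<open>L ** X\<close> from its
      transpose \<open>X ** L\<close>, so orthogonality to the first gives orthogonality to the
      sum.\<close>
    have XL: "sym_unit i j \<bullet> (X ** L) = sym_unit i j \<bullet> (L ** X)"
      using X sym(1) sym_mat_sym_unit[of i j] inner_transpose[of "sym_unit i j" "X ** L"]
      by (simp add: matrix_transpose_mul sym_mat_def)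
    show ?thesis unfolding inner_add_right XL LX inner_minus_right eq(2) by simp
  qed
  hence "L ** X + X ** L = 0"
    using sym_mat_eq_0_of_sym_unit sym_mat_anticommutator[OF sym(1) X] by blast
  hence "X = 0" by (rule sylvester_eq_0[OF L L])
  thus "m = sample_mean n x \<and> sample_cov n x = P ** P" using m by (simp add: X_def)
next
  assume "m = sample_mean n x \<and> sample_cov n x = P ** P"
  hence m: "sample_mean n x - m = 0" and "moment n x m = P ** P" by (auto simp: sample_cov_eq_moment)
  hence "P - L ** moment n x m = 0" by (simp add: matrix_mul_assoc P)
  thus "(m, L) \<in> mle_set (ell_model gauss_density) n x"
    using L m unfolding mle_set_def mem_Collect_eq ball_param_dirs param_deriv_ln_ell_model average_loglik_score[OF n]
    by (simp add: param_space_def)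
qed

lemma gauss_w_score_exists:
  assumes "sym_mat V"
  obtains H where "sym_mat H" "(L ** L) ** H + H ** (L ** L) = - (L ** V + V ** L)"
    "\<And>u. w_score (ell_model gauss_density) (m, L) (u, V) (gauss_w_score u H)"
proof -
  have "sym_mat (- (L ** V + V ** L))"
    using sym_mat_anticommutator[OF sym(1) assms] by (simp only: sym_mat_def transpose_uminus)
  then obtain H where "sym_mat H" "(L ** L) ** H + H ** (L ** L) = - (L ** V + V ** L)"
    using lyapunov_solvable[OF pos_def_square[OF L]] by blast
  thus ?thesis using that w_score_gauss_w_score[OF _ assms] by blast
qed

lemma wass_set_iff:
  assumes n: "n > 0"
  shows "(m, L) \<in> wass_set (ell_model gauss_density) n x
    \<longleftrightarrow> m = sample_mean n x \<and> sample_cov n x = P ** P"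
proof
  assume "(m, L) \<in> wass_set (ell_model gauss_density) n x"
  hence ex: "\<And>i. \<exists>S. w_score (ell_model gauss_density) (m, L) (axis i 1, 0) S \<and> (1 / real n) * (\<Sum>t=1..n. S (x t)) = 0"
    "\<And>i j. \<exists>S. w_score (ell_model gauss_density) (m, L) (0, sym_unit i j) S \<and> (1 / real n) * (\<Sum>t=1..n. S (x t)) = 0"
    unfolding wass_set_def ball_param_dirs by blast+
  \<comment> \<open>The witness in \<open>wass_set\<close> is an unspecified score; uniqueness
    identifies it with the explicit one, whose average is known.\<close>
  have eq: "u \<bullet> (sample_mean n x - m) + H \<bullet> (moment n x m - P ** P) / 2 = 0"
    if "w_score (ell_model gauss_density) (m, L) v (gauss_w_score u H)"
      "\<exists>S. w_score (ell_model gauss_density) (m, L) v S \<and> (1 / real n) * (\<Sum>t=1..n. S (x t)) = 0" for u v H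
    using that w_score_unique unfolding average_gauss_w_score[OF n, symmetric] by blast
  have "axis i 1 \<bullet> (sample_mean n x - m) = 0" for i
  proof -
    have "w_score (ell_model gauss_density) (m, L) (axis i 1, 0) (gauss_w_score (axis i 1) 0)"
      by (rule w_score_gauss_w_score)
        (simp_all add: sym_mat_def transpose_def vec_eq_iff matrix_matrix_mult_def)
    from eq[OF this ex(1)] show ?thesis by simp
  qed
  hence m: "m = sample_mean n x" by (rule mean_eq_of_axis)
  define X where "X = sample_cov n x - P ** P"
  have "sym_mat X" using sym sym_mat_moment[of n x]
    by (simp add: X_def sample_cov_eq_moment sym_mat_def transpose_diff)
  \<comment> \<open>The test matrices \<open>H\<close> are known only through the Lyapunov equation
    they solve. Writing \<open>X\<close> as a Lyapunov image as well lets self-adjointness turn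
    \<open>H \<bullet> X = 0\<close> into an equation between the symmetric unit and
    \<open>Y\<close>.\<close>
  then obtain Y where Y: "sym_mat Y" "(L ** L) ** Y + Y ** (L ** L) = X"
    using lyapunov_solvable[OF pos_def_square[OF L]] by blast
  have "sym_unit i j \<bullet> (L ** Y + Y ** L) = 0" for i j
  proof -
    obtain H where H: "sym_mat H"
      "(L ** L) ** H + H ** (L ** L) = - (L ** sym_unit i j + sym_unit i j ** L)"
      "w_score (ell_model gauss_density) (m, L) (0, sym_unit i j) (gauss_w_score 0 H)"
      using gauss_w_score_exists[OF sym_mat_sym_unit] by metis
    have "H \<bullet> X = 0"
      using eq[OF H(3) ex(2)] by (simp add: X_def sample_cov_eq_moment m)
    hence "(- (L ** sym_unit i j + sym_unit i j ** L)) \<bullet> Y = 0"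
      using pos_def_square[OF L]
      unfolding Y(2)[symmetric] H(2)[symmetric] by (subst (asm) inner_anticommutator_right) (auto simp: pos_def_def)
    thus ?thesis
      unfolding inner_anticommutator_right[OF sym(1)] inner_minus_left by simp
  qed
  hence "L ** Y + Y ** L = 0"
    using sym_mat_eq_0_of_sym_unit sym_mat_anticommutator[OF sym(1) Y(1)] by blast
  hence "Y = 0" by (rule sylvester_eq_0[OF L L])
  hence "X = 0" using Y(2) by simp
  thus "m = sample_mean n x \<and> sample_cov n x = P ** P" using m by (simp add: X_def)
next
  assume "m = sample_mean n x \<and> sample_cov n x = P ** P"
  hence *: "sample_mean n x - m = 0" "moment n x m - P ** P = 0" by (auto simp: sample_cov_eq_moment)
  have "\<exists>S. w_score (ell_model gauss_density) (m, L) (u, V) S \<and> (1 / real n) * (\<Sum>t=1..n. S (x t)) = 0"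
    if V: "sym_mat V" for u V
  proof -
    obtain H where "w_score (ell_model gauss_density) (m, L) (u, V) (gauss_w_score u H)"
      using gauss_w_score_exists[OF V] by metis
    moreover have "(1 / real n) * (\<Sum>t=1..n. gauss_w_score u H (x t)) = 0"
      unfolding average_gauss_w_score[OF n] * by simp
    ultimately show ?thesis by blast
  qed
  moreover have "sym_mat (0 :: real^'d^'d)" by (simp add: sym_mat_def transpose_def vec_eq_iff)
  ultimately show "(m, L) \<in> wass_set (ell_model gauss_density) n x"
    using L sym_mat_sym_unit unfolding wass_set_def ball_param_dirs param_space_def by blast
qed

end

text \<open>Existence and uniqueness of the root justify the definite description in
  \<open>inv_sqrt\<close>.\<close>

lemma inv_sqrt:
  fixes S :: "real^'d^'d"
  assumes S: "pos_def S"
  shows pos_def_inv_sqrt: "pos_def (inv_sqrt S)" and inv_sqrt_square: "inv_sqrt S ** inv_sqrt S = matrix_inv S"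
proof -
  obtain R where R: "pos_def R" "R ** R = matrix_inv S"
    by (rule pos_def_sqrt_exists[OF pos_def_matrix_inv(3)[OF S]])
  have "inv_sqrt S = R"
    unfolding inv_sqrt_def
  proof (rule the_equality)
    show "M = R" if "pos_def M \<and> M ** M = matrix_inv S" for M
      using that R pos_def_sqrt_unique[of M R] by simp
  qed (use R in simp)
  thus "pos_def (inv_sqrt S)" "inv_sqrt S ** inv_sqrt S = matrix_inv S" using R by simp_all
qed

text \<open>Both sides of the equivalence express that \<open>L ** L\<close> is the inverse of
  \<open>S\<close>.\<close>

lemma inv_sqrt_unique:
  fixes S L :: "real^'d^'d"
  assumes S: "pos_def S" and L: "pos_def L"
  shows "S = matrix_inv L ** matrix_inv L \<longleftrightarrow> L = inv_sqrt S"
proof -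
  let ?PP = "matrix_inv L ** matrix_inv L"
  have LP: "(L ** L) ** ?PP = mat 1" "?PP ** (L ** L) = mat 1"
    by (metis L matrix_mul_assoc matrix_mul_rid pos_def_matrix_inv(1),
        metis L matrix_mul_assoc matrix_mul_rid pos_def_matrix_inv(2))
  have "L ** L = matrix_inv S" if "S = ?PP"
    using LP(2) pos_def_matrix_inv(2)[OF S] that by (metis matrix_mul_assoc matrix_mul_lid matrix_mul_rid)
  moreover have "S = ?PP" if "L ** L = matrix_inv S"
    using LP(1) pos_def_matrix_inv(1)[OF S] that by (metis matrix_mul_assoc matrix_mul_lid matrix_mul_rid)
  moreover have "L ** L = matrix_inv S \<longleftrightarrow> L = inv_sqrt S"
    using pos_def_sqrt_unique[OF L pos_def_inv_sqrt[OF S]] inv_sqrt_square[OF S] by auto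
  ultimately show ?thesis by blast
qed

theorem mainTheorem4:
  fixes x :: "nat \<Rightarrow> real^'d" and n :: nat
  assumes "pos_def (sample_cov n x)"
  shows "mle_set (ell_model gauss_density) n x = {(sample_mean n x, inv_sqrt (sample_cov n x))}
       \<and> wass_set (ell_model gauss_density) n x = {(sample_mean n x, inv_sqrt (sample_cov n x))}"
proof -
  \<comment> \<open>For \<open>n = 0\<close> the sample covariance is an empty sum scaled by
    \<open>1 / 0 = 0\<close>, hence zero and not positive definite.\<close>
  have n: "n > 0"
  proof (rule ccontr)
    assume "\<not> n > 0"
    hence "sample_cov n x = 0" by (simp add: sample_cov_def)
    moreover obtain v :: "real^'d" where "norm v = 1" using vector_choose_size[of 1] by auto
    hence "v \<noteq> 0" by auto
    ultimately show False using assms by (auto simp: pos_def_def)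
  qed
  have mle: "(m, L) \<in> mle_set (ell_model gauss_density) n x
      \<longleftrightarrow> m = sample_mean n x \<and> L = inv_sqrt (sample_cov n x)"
    and wass: "(m, L) \<in> wass_set (ell_model gauss_density) n x
      \<longleftrightarrow> m = sample_mean n x \<and> L = inv_sqrt (sample_cov n x)" if L: "pos_def L" for m L
  proof -
    interpret gaussian_model m L by unfold_locales (rule L)
    show "(m, L) \<in> mle_set (ell_model gauss_density) n x
      \<longleftrightarrow> m = sample_mean n x \<and> L = inv_sqrt (sample_cov n x)"
      using mle_set_iff[OF n] inv_sqrt_unique[OF assms L] by (simp add: P_def)
    show "(m, L) \<in> wass_set (ell_model gauss_density) n x
      \<longleftrightarrow> m = sample_mean n x \<and> L = inv_sqrt (sample_cov n x)"
      using wass_set_iff[OF n] inv_sqrt_unique[OF assms L] by (simp add: P_def)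
  qed
  have "\<theta> \<in> mle_set (ell_model gauss_density) n x \<longleftrightarrow> \<theta> = (sample_mean n x, inv_sqrt (sample_cov n x))"
    "\<theta> \<in> wass_set (ell_model gauss_density) n x \<longleftrightarrow> \<theta> = (sample_mean n x, inv_sqrt (sample_cov n x))" for \<theta>
  proof -
    obtain m L where \<theta>: "\<theta> = (m, L)" by (cases \<theta>)
    \<comment> \<open>If \<open>L\<close> is not positive definite, both memberships and the
      equality fail: the sets lie in \<open>param_space\<close>, and \<open>inv_sqrt\<close> of the
      sample covariance is positive definite.\<close>
    consider "pos_def L" | "\<not> pos_def L" "L \<noteq> inv_sqrt (sample_cov n x)"
      using pos_def_inv_sqrt[OF assms] by auto
    hence "(\<theta> \<in> mle_set (ell_model gauss_density) n x \<longleftrightarrow> \<theta> = (sample_mean n x, inv_sqrt (sample_cov n x)))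
      \<and> (\<theta> \<in> wass_set (ell_model gauss_density) n x \<longleftrightarrow> \<theta> = (sample_mean n x, inv_sqrt (sample_cov n x)))"
    proof cases
      case 1
      show ?thesis unfolding \<theta> mle[OF 1] wass[OF 1] by simp
    next
      case 2
      thus ?thesis unfolding \<theta> by (simp add: mle_set_def wass_set_def param_space_def)
    qed
    thus "\<theta> \<in> mle_set (ell_model gauss_density) n x \<longleftrightarrow> \<theta> = (sample_mean n x, inv_sqrt (sample_cov n x))"
      "\<theta> \<in> wass_set (ell_model gauss_density) n x \<longleftrightarrow> \<theta> = (sample_mean n x, inv_sqrt (sample_cov n x))"
      by blast+
  qed
  thus ?thesis by blast
qed

end
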